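(* Let $(X,d_X)$ and $(Y,d_Y)$ be uniformly locally finite metric spaces. If the quasi-local algebras $\mathrm{C}^*_{ql}(X)$ and $\mathrm{C}^*_{ql}(Y)$ are $^*$-isomorphic, then $X$ and $Y$ are bijectively coarsely equivalent.
   Context: A metric space $(X,d)$ is uniformly locally finite (u.l.f.) if $\sup_{x\in X}|B_r(x)|<\infty$ for every $r>0$. For $A\subseteq X$, $\chi_A$ denotes the orthogonal projection of $\ell_2(X)$ onto $\ell_2(A)$. An operator $a\in\mathcal B(\ell_2(X))$ is quasi-local if for every $\varepsilon>0$ there is $r>0$ such that $\|\chi_A a\chi_B\|<\varepsilon$ for all $A,B\subseteq X$ with $d(A,B)\ge r$; $\mathrm{C}^*_{ql}(X)$ denotes the $\mathrm{C}^*$-algebra of quasi-local operators. A map $f\colon X\to Y$ is coarse if for every $r>0$ there is $s>0$ with $d_X(x,x')\le r\Rightarrow d_Y(f(x),f(x'))\le s$; $f,g$ are close if $\sup_x d_Y(f(x),g(x))<\infty$; $f$ is a coarse equivalence if there is a coarse $g\colon Y\to X$ with $f\circ g$ close to $\mathrm{Id}_Y$ and $g\circ f$ close to $\mathrm{Id}_X$. Bijectively coarsely equivalent means there is a bijective coarse equivalence $X\to Y$. *)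

theory Defs
  imports "HOL-Analysis.Analysis"
begin

definition ulf :: "'a set \<Rightarrow> ('a \<Rightarrow> 'a \<Rightarrow> real) \<Rightarrow> bool" where
  "ulf X d \<longleftrightarrow> (\<forall>r>0. \<exists>N::nat. \<forall>x\<in>X.
      finite {y\<in>X. d x y \<le> r} \<and> card {y\<in>X. d x y \<le> r} \<le> N)"

definition coarse_map :: "'a set \<Rightarrow> ('a \<Rightarrow> 'a \<Rightarrow> real) \<Rightarrow> ('b \<Rightarrow> 'b \<Rightarrow> real) \<Rightarrow> ('a \<Rightarrow> 'b) \<Rightarrow> bool" where
  "coarse_map X dX dY f \<longleftrightarrow> (\<forall>r>0. \<exists>s>0. \<forall>x\<in>X. \<forall>x'\<in>X. dX x x' \<le> r \<longrightarrow> dY (f x) (f x') \<le> s)"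

definition close_maps :: "'a set \<Rightarrow> ('b \<Rightarrow> 'b \<Rightarrow> real) \<Rightarrow> ('a \<Rightarrow> 'b) \<Rightarrow> ('a \<Rightarrow> 'b) \<Rightarrow> bool" where
  "close_maps X dY f g \<longleftrightarrow> (\<exists>C. \<forall>x\<in>X. dY (f x) (g x) \<le> C)"

definition coarse_equivalence ::
  "'a set \<Rightarrow> ('a \<Rightarrow> 'a \<Rightarrow> real) \<Rightarrow> 'b set \<Rightarrow> ('b \<Rightarrow> 'b \<Rightarrow> real) \<Rightarrow> ('a \<Rightarrow> 'b) \<Rightarrow> bool" where
  "coarse_equivalence X dX Y dY f \<longleftrightarrow>
     f ` X \<subseteq> Y \<and> coarse_map X dX dY f \<and>
     (\<exists>g. g ` Y \<subseteq> X \<and> coarse_map Y dY dX g \<and>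
          close_maps Y dY (f \<circ> g) id \<and> close_maps X dX (g \<circ> f) id)"

definition bij_coarse_equiv ::
  "'a set \<Rightarrow> ('a \<Rightarrow> 'a \<Rightarrow> real) \<Rightarrow> 'b set \<Rightarrow> ('b \<Rightarrow> 'b \<Rightarrow> real) \<Rightarrow> bool" where
  "bij_coarse_equiv X dX Y dY \<longleftrightarrow> (\<exists>f. bij_betw f X Y \<and> coarse_equivalence X dX Y dY f)"

definition l2 :: "'a set \<Rightarrow> ('a \<Rightarrow> complex) set" where
  "l2 X = {f. (\<forall>x. x \<notin> X \<longrightarrow> f x = 0) \<and> (\<lambda>x. (cmod (f x))\<^sup>2) summable_on X}"

definition l2_inner :: "'a set \<Rightarrow> ('a \<Rightarrow> complex) \<Rightarrow> ('a \<Rightarrow> complex) \<Rightarrow> complex" where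
  "l2_inner X f g = infsum (\<lambda>x. f x * cnj (g x)) X"

definition l2_norm :: "'a set \<Rightarrow> ('a \<Rightarrow> complex) \<Rightarrow> real" where
  "l2_norm X f = sqrt (infsum (\<lambda>x. (cmod (f x))\<^sup>2) X)"

type_synonym 'a op = "('a \<Rightarrow> complex) \<Rightarrow> ('a \<Rightarrow> complex)"

text \<open>Bounded linear operators on l2(X); made extensional by requiring value 0 off l2(X).\<close>

definition bops :: "'a set \<Rightarrow> 'a op set" where
  "bops X = {a.
     (\<forall>f\<in>l2 X. a f \<in> l2 X) \<and>
     (\<forall>f\<in>l2 X. \<forall>g\<in>l2 X. \<forall>c. a (\<lambda>x. c * f x + g x) = (\<lambda>x. c * a f x + a g x)) \<and>
     (\<exists>K. \<forall>f\<in>l2 X. l2_norm X (a f) \<le> K * l2_norm X f) \<and>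
     (\<forall>f. f \<notin> l2 X \<longrightarrow> a f = (\<lambda>_. 0))}"

definition op_norm :: "'a set \<Rightarrow> 'a op \<Rightarrow> real" where
  "op_norm X a = Sup {l2_norm X (a f) | f. f \<in> l2 X \<and> l2_norm X f \<le> 1}"

definition proj :: "'a set \<Rightarrow> 'a op" where
  "proj A f = (\<lambda>x. if x \<in> A then f x else 0)"

definition is_adjoint :: "'a set \<Rightarrow> 'a op \<Rightarrow> 'a op \<Rightarrow> bool" where
  "is_adjoint X a b \<longleftrightarrow> (\<forall>f\<in>l2 X. \<forall>g\<in>l2 X. l2_inner X (a f) g = l2_inner X f (b g))"

definition adjoint :: "'a set \<Rightarrow> 'a op \<Rightarrow> 'a op" where
  "adjoint X a = (THE b. b \<in> bops X \<and> is_adjoint X a b)"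

text \<open>Quasi-locality; d(A,B) \<ge> r is written out as: all pairs are at distance \<ge> r.\<close>

definition quasi_local :: "'a set \<Rightarrow> ('a \<Rightarrow> 'a \<Rightarrow> real) \<Rightarrow> 'a op \<Rightarrow> bool" where
  "quasi_local X d a \<longleftrightarrow> (\<forall>\<epsilon>>0. \<exists>r>0. \<forall>A B. A \<subseteq> X \<longrightarrow> B \<subseteq> X \<longrightarrow>
      (\<forall>x\<in>A. \<forall>y\<in>B. d x y \<ge> r) \<longrightarrow> op_norm X (proj A \<circ> a \<circ> proj B) < \<epsilon>)"

definition Cql :: "'a set \<Rightarrow> ('a \<Rightarrow> 'a \<Rightarrow> real) \<Rightarrow> 'a op set" where
  "Cql X d = {a \<in> bops X. quasi_local X d a}"

definition star_isomorphism ::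
  "'a set \<Rightarrow> ('a \<Rightarrow> 'a \<Rightarrow> real) \<Rightarrow> 'b set \<Rightarrow> ('b \<Rightarrow> 'b \<Rightarrow> real) \<Rightarrow> ('a op \<Rightarrow> 'b op) \<Rightarrow> bool" where
  "star_isomorphism X dX Y dY \<phi> \<longleftrightarrow>
     bij_betw \<phi> (Cql X dX) (Cql Y dY) \<and>
     (\<forall>a\<in>Cql X dX. \<forall>b\<in>Cql X dX. \<forall>c::complex.
        \<phi> (\<lambda>f x. c * a f x + b f x) = (\<lambda>g y. c * \<phi> a g y + \<phi> b g y)) \<and>
     (\<forall>a\<in>Cql X dX. \<forall>b\<in>Cql X dX. \<phi> (a \<circ> b) = \<phi> a \<circ> \<phi> b) \<and>
     (\<forall>a\<in>Cql X dX. \<phi> (adjoint X a) = adjoint Y (\<phi> a))"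

end

theory Submission
  imports Defs
begin

text \<open>
  Write \<open>P S\<close> for the image in the quasi-local algebra of \<open>Y\<close> of the projection onto \<open>l2 S\<close>, and put
  \<open>m {x} y = \<langle>P {x} \<delta>\<^sub>y, \<delta>\<^sub>y\<rangle>\<close>; comparing \<open>e\<^sub>y P {x} e\<^sub>y = m {x} y \<cdot> e\<^sub>y\<close> with its preimage shows that the
  inverse isomorphism gives the same numbers.

  A Baire category argument makes the projections \<open>P S\<close> quasi-local uniformly in \<open>S\<close>. Averaging
  \<open>P S - P (A - S)\<close> over random signs then gives two things. First, a fixed proportion of \<open>\<delta>\<^sub>y\<close> lives
  in a ball with boundedly many points, so some entry \<open>m {x} y\<close> is bounded below; this yields maps
  \<open>f : X \<rightarrow> Y\<close> and \<open>g : Y \<rightarrow> X\<close> that are coarse and inverse to each other up to closeness. Second, if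
  for a finite set \<open>A\<close> the neighbourhood \<open>N\<close> of \<open>f ` A\<close> had fewer points than \<open>A\<close>, a nonzero combination of
  the orthogonal vectors \<open>P {x} \<delta>\<^bsub>f x\<^esub>\<close> would vanish on \<open>N\<close>, and a suitable choice of signs would move a
  fixed proportion of it onto \<open>f ` A\<close>, contradicting quasi-locality. Hence Hall's condition holds with a
  uniform radius in both directions, and the Cantor-Bernstein construction glues the two injections
  into a bijection close to \<open>f\<close>.
\<close>

section \<open>Combinatorial and linear-algebraic preliminaries\<close>

text \<open>A star isomorphism is here a purely algebraic map: nothing is assumed about continuity,
  a unitary implementing it, or infinite sums of orthogonal projections. So it is not clear in
  advance that \<open>P S\<close> is governed by the \<open>P {x}\<close> with x in S. The symmetry
  of the numbers \<open>m {x} y\<close> repairs this: a nonzero vector in the range of the preimage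
  of e_y has coordinates bounded through \<open>m {x} y\<close>, which forces these numbers to sum
  to 1 over x. The resulting tail bound lets finite sets stand in for arbitrary ones, both in the
  category argument and in the averaging. Quasi-locality gives each operator its own scale, whereas
  coarse maps and Hall's condition need one scale for all points. Signs respect this:
  \<open>P (A \<inter> S)\<close> and \<open>P (A - S)\<close> obey the uniform scale for every S,
  and since the \<open>P {x}\<close> have orthogonal ranges, the norm of the signed vector does not
  depend on the signs. The freedom in S can be spent entirely on what happens at finitely many
  coordinates.\<close>

lemma Hall_injection:
  fixes N :: "'a \<Rightarrow> 'b set"
  assumes fin: "\<And>x. x \<in> X \<Longrightarrow> finite (N x)"
    and hall: "\<And>A. finite A \<Longrightarrow> A \<subseteq> X \<Longrightarrow> card A \<le> card (\<Union>x\<in>A. N x)"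
  shows "\<exists>F. inj_on F X \<and> (\<forall>x\<in>X. F x \<in> N x)"
proof -
  \<comment> \<open>\<open>D\<close> is a set of deleted edges. Zorn's lemma yields a maximal
    deletion that still satisfies Hall's condition; each point then has exactly one neighbour left,
    and these neighbours form the injection.\<close>
  define R where "R D x = {y \<in> N x. (x, y) \<notin> D}" for D x
  define \<H> where "\<H> = {D. \<forall>A. finite A \<longrightarrow> A \<subseteq> X \<longrightarrow> card A \<le> card (\<Union>x\<in>A. R D x)}"
  have finR: "finite (R D x)" if "x \<in> X" for D x
    using fin[OF that] by (simp add: R_def)
  have "\<exists>M\<in>\<H>. \<forall>D\<in>\<H>. M \<subseteq> D \<longrightarrow> D = M"
  proof (rule subset_Zorn')
    fix C assume C: "subset.chain \<H> C"
    show "\<Union>C \<in> \<H>"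
    proof (cases "C = {}")
      case True
      then show ?thesis using hall by (simp add: \<H>_def R_def)
    next
      case False
      have "card A \<le> card (\<Union>x\<in>A. R (\<Union>C) x)" if A: "finite A" "A \<subseteq> X" for A
      proof -
        \<comment> \<open>Only finitely many edges start in \<open>A\<close>, so one member of the
          chain already deletes all those that the union deletes there.\<close>
        have "finite (Sigma A N)"
          using A fin by (intro finite_SigmaI) auto
        then have "finite (\<Union>C \<inter> Sigma A N)" by blast
        then obtain D where D: "D \<in> C" "\<Union>C \<inter> Sigma A N \<subseteq> D"
          using finite_subset_Union_chain[OF _ Int_lower1 False C] by metis
        have "R (\<Union>C) x = R D x" if "x \<in> A" for x
          using D that by (auto simp: R_def)
        moreover have "D \<in> \<H>" using C D(1) by (auto simp: subset.chain_def)
        ultimately show ?thesis using A by (simp add: \<H>_def)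
      qed
      then show ?thesis by (simp add: \<H>_def)
    qed
  qed
  then obtain M where M: "M \<in> \<H>" and max: "\<And>D. D \<in> \<H> \<Longrightarrow> M \<subseteq> D \<Longrightarrow> D = M"
    by blast
  have hM: "card A \<le> card (\<Union>x\<in>A. R M x)" if "finite A" "A \<subseteq> X" for A
    using M that by (simp add: \<H>_def)
  have tight: "\<exists>J. finite J \<and> J \<subseteq> X \<and> x \<notin> J \<and> card ((\<Union>z\<in>J. R M z) \<union> (R M x - {a})) \<le> card J"
    if x: "x \<in> X" and a: "a \<in> R M x" for x a
  proof -
    have "(x, a) \<notin> M" using a by (simp add: R_def)
    then have "insert (x, a) M \<notin> \<H>" using max[of "insert (x, a) M"] by blast
    then obtain A where A: "finite A" "A \<subseteq> X" "card (\<Union>z\<in>A. R (insert (x, a) M) z) < card A"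
      by (auto simp: \<H>_def not_le)
    have "x \<in> A"
    proof (rule ccontr)
      assume "x \<notin> A"
      then have "(\<Union>z\<in>A. R (insert (x, a) M) z) = (\<Union>z\<in>A. R M z)"
        unfolding R_def by blast
      then show False using A hM[of A] by simp
    qed
    have "(\<Union>z\<in>A. R (insert (x, a) M) z) = (\<Union>z\<in>A - {x}. R M z) \<union> (R M x - {a})"
      using \<open>x \<in> A\<close> unfolding R_def by blast
    then have "card ((\<Union>z\<in>A - {x}. R M z) \<union> (R M x - {a})) \<le> card (A - {x})"
      using A \<open>x \<in> A\<close> by simp
    then show ?thesis using A by (intro exI[of _ "A - {x}"]) auto
  qed
  have single: "\<exists>y. R M x = {y}" if x: "x \<in> X" for x
  proof -
    have "card {x} \<le> card (\<Union>x\<in>{x}. R M x)" using hM[of "{x}"] x by blast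
    then have "R M x \<noteq> {}" by auto
    then obtain a where a: "a \<in> R M x" by blast
    have "b = a" if b: "b \<in> R M x" for b
    proof (rule ccontr)
      assume "b \<noteq> a"
      obtain J where J: "finite J" "J \<subseteq> X" "x \<notin> J" "card ((\<Union>z\<in>J. R M z) \<union> (R M x - {a})) \<le> card J"
        using tight[OF x a] by blast
      obtain K where K: "finite K" "K \<subseteq> X" "x \<notin> K" "card ((\<Union>z\<in>K. R M z) \<union> (R M x - {b})) \<le> card K"
        using tight[OF x b] by blast
      \<comment> \<open>\<open>P\<close> and \<open>Q\<close> witness that neither edge at
        \<open>x\<close> can be deleted. As \<open>a\<close> and \<open>b\<close> differ,
        \<open>P \<union> Q\<close> contains every neighbour of \<open>x\<close>; Hall's condition
        for \<open>insert x (J \<union> K)\<close> and for \<open>J \<inter> K\<close> then gives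
        \<open>card P + card Q > card J + card K\<close>.\<close>
      define P where "P = (\<Union>z\<in>J. R M z) \<union> (R M x - {a})"
      define Q where "Q = (\<Union>z\<in>K. R M z) \<union> (R M x - {b})"
      have fP: "finite P" and fQ: "finite Q"
        using J(1,2) K(1,2) finR x by (auto simp: P_def Q_def)
      have "card (insert x (J \<union> K)) \<le> card (\<Union>z\<in>insert x (J \<union> K). R M z)"
        using J K x by (intro hM) auto
      also have "\<dots> \<le> card (P \<union> Q)"
        using fP fQ \<open>b \<noteq> a\<close> by (intro card_mono) (auto simp: P_def Q_def)
      finally have 1: "card (J \<union> K) + 1 \<le> card (P \<union> Q)"
        using J K by simp
      have "card (J \<inter> K) \<le> card (\<Union>z\<in>J \<inter> K. R M z)"
        using J K by (intro hM) auto
      also have "\<dots> \<le> card (P \<inter> Q)"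
        using fP fQ by (intro card_mono) (auto simp: P_def Q_def)
      finally have 2: "card (J \<inter> K) \<le> card (P \<inter> Q)" .
      have "card P + card Q = card (P \<union> Q) + card (P \<inter> Q)"
        using fP fQ by (rule card_Un_Int)
      moreover have "card J + card K = card (J \<union> K) + card (J \<inter> K)"
        using J K by (intro card_Un_Int)
      ultimately show False using 1 2 J(4) K(4) by (simp add: P_def Q_def)
    qed
    then show ?thesis using a by blast
  qed
  then obtain F where F: "\<And>x. x \<in> X \<Longrightarrow> R M x = {F x}" by metis
  have "inj_on F X"
  proof (rule inj_onI, rule ccontr)
    fix x x' assume *: "x \<in> X" "x' \<in> X" "F x = F x'" "x \<noteq> x'"
    then have "(\<Union>z\<in>{x, x'}. R M z) = {F x}" using F by auto
    then show False using hM[of "{x, x'}"] * by simp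
  qed
  moreover have "F x \<in> N x" if "x \<in> X" for x
    using F[OF that] by (auto simp: R_def)
  ultimately show ?thesis by blast
qed

text \<open>A least fixed point \<open>S\<close> separates the points where \<open>F\<close> is used
  from those where the inverse of \<open>G\<close> is used. The second conclusion records this
  choice pointwise, since closeness to the original coarse map is read off from it.\<close>

lemma Cantor_Bernstein_pieces:
  assumes F: "inj_on F X" "F ` X \<subseteq> Y" and G: "inj_on G Y" "G ` Y \<subseteq> X"
  shows "\<exists>h. bij_betw h X Y \<and> (\<forall>x\<in>X. h x = F x \<or> G (h x) = x)"
proof -
  define S where "S = lfp (\<lambda>S. X - G ` (Y - F ` S))"
  have "mono (\<lambda>S. X - G ` (Y - F ` S))" by (rule monoI) blast
  then have S: "S = X - G ` (Y - F ` S)"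
    unfolding S_def by (rule lfp_unfold)
  then have SX: "S \<subseteq> X" by blast
  have inv: "inv_into Y G x \<in> Y - F ` S \<and> G (inv_into Y G x) = x" if "x \<in> X - S" for x
  proof -
    from that S obtain y where y: "y \<in> Y - F ` S" "x = G y" by blast
    then show ?thesis using G(1) by simp
  qed
  have invG: "inv_into Y G (G y) = y" if "y \<in> Y" for y
    using G(1) that by simp
  define h where "h x = (if x \<in> S then F x else inv_into Y G x)" for x
  have "bij_betw h S (F ` S)"
    using inj_on_subset[OF F(1) SX] by (auto simp: bij_betw_def h_def inj_on_def)
  moreover have "bij_betw h (X - S) (Y - F ` S)"
  proof (rule bij_betw_byWitness[where f' = G])
    show "\<forall>x\<in>X - S. G (h x) = x" using inv by (simp add: h_def)
    show "\<forall>y\<in>Y - F ` S. h (G y) = y" using S invG by (auto simp: h_def)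
    show "h ` (X - S) \<subseteq> Y - F ` S" using inv by (auto simp: h_def)
    show "G ` (Y - F ` S) \<subseteq> X - S" using S G(2) by blast
  qed
  ultimately have "bij_betw h (S \<union> (X - S)) (F ` S \<union> (Y - F ` S))"
    by (rule bij_betw_combine) blast
  moreover have "S \<union> (X - S) = X" "F ` S \<union> (Y - F ` S) = Y"
    using S F(2) by blast+
  moreover have "h x = F x \<or> G (h x) = x" if "x \<in> X" for x
    using inv that by (simp add: h_def)
  ultimately show ?thesis by metis
qed

section \<open>Parallelogram law, choice of signs, linear systems\<close>

lemma parallelogram_cmod:
  "(cmod (a + b))\<^sup>2 + (cmod (a - b))\<^sup>2 = 2 * (cmod a)\<^sup>2 + 2 * (cmod b)\<^sup>2"
  unfolding cmod_power2 by (simp add: power2_eq_square algebra_simps)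

lemma parallelogram_sum_cmod:
  "(\<Sum>z\<in>B. (cmod (f z + g z))\<^sup>2) + (\<Sum>z\<in>B. (cmod (f z - g z))\<^sup>2)
    = 2 * (\<Sum>z\<in>B. (cmod (f z))\<^sup>2) + 2 * (\<Sum>z\<in>B. (cmod (g z))\<^sup>2)"
  by (simp add: sum.distrib[symmetric] sum_distrib_left parallelogram_cmod)

text \<open>Random signs without probability: when a vector is added, its two signs give the sum of
  the squares on average, so one of them does not exceed it. \<open>S\<close> collects the indices
  with sign plus.\<close>

lemma exists_signs_le:
  fixes v :: "'a \<Rightarrow> 'b \<Rightarrow> complex"
  assumes "finite A"
  shows "\<exists>S. (\<Sum>z\<in>B. (cmod ((\<Sum>x\<in>A \<inter> S. v x z) - (\<Sum>x\<in>A - S. v x z)))\<^sup>2)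
      \<le> (\<Sum>x\<in>A. \<Sum>z\<in>B. (cmod (v x z))\<^sup>2)"
  using assms
proof (induction A)
  case (insert a A)
  then obtain S where S: "(\<Sum>z\<in>B. (cmod ((\<Sum>x\<in>A \<inter> S. v x z) - (\<Sum>x\<in>A - S. v x z)))\<^sup>2)
      \<le> (\<Sum>x\<in>A. \<Sum>z\<in>B. (cmod (v x z))\<^sup>2)" by blast
  define w where "w z = (\<Sum>x\<in>A \<inter> S. v x z) - (\<Sum>x\<in>A - S. v x z)" for z
  have "A \<inter> insert a S = A \<inter> S" "A - insert a S = A - S" "A \<inter> (S - {a}) = A \<inter> S" "A - (S - {a}) = A - S"
    using insert.hyps by auto
  then have plus: "(\<Sum>x\<in>insert a A \<inter> insert a S. v x z) - (\<Sum>x\<in>insert a A - insert a S. v x z) = w z + v a z"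
    and minus: "(\<Sum>x\<in>insert a A \<inter> (S - {a}). v x z) - (\<Sum>x\<in>insert a A - (S - {a}). v x z) = w z - v a z" for z
    using insert.hyps by (simp_all add: w_def insert_Diff_if)
  have "(\<Sum>z\<in>B. (cmod (w z + v a z))\<^sup>2) + (\<Sum>z\<in>B. (cmod (w z - v a z))\<^sup>2)
     = 2 * (\<Sum>z\<in>B. (cmod (w z))\<^sup>2) + 2 * (\<Sum>z\<in>B. (cmod (v a z))\<^sup>2)"
    by (rule parallelogram_sum_cmod)
  then consider "(\<Sum>z\<in>B. (cmod (w z + v a z))\<^sup>2) \<le> (\<Sum>z\<in>B. (cmod (w z))\<^sup>2) + (\<Sum>z\<in>B. (cmod (v a z))\<^sup>2)"
    | "(\<Sum>z\<in>B. (cmod (w z - v a z))\<^sup>2) \<le> (\<Sum>z\<in>B. (cmod (w z))\<^sup>2) + (\<Sum>z\<in>B. (cmod (v a z))\<^sup>2)"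
    by linarith
  then show ?case
  proof cases
    case 1
    then show ?thesis
      using S insert.hyps unfolding plus[symmetric] by (intro exI[of _ "insert a S"]) (simp add: w_def)
  next
    case 2
    then show ?thesis
      using S insert.hyps unfolding minus[symmetric] by (intro exI[of _ "S - {a}"]) (simp add: w_def)
  qed
qed simp

text \<open>The larger of the two values in the same average; this direction forces mass onto
  \<open>B\<close> instead of removing it.\<close>

lemma exists_signs_ge:
  fixes v :: "'a \<Rightarrow> 'b \<Rightarrow> complex"
  assumes "finite A"
  shows "\<exists>S. (\<Sum>x\<in>A. \<Sum>z\<in>B. (cmod (v x z))\<^sup>2)
      \<le> (\<Sum>z\<in>B. (cmod ((\<Sum>x\<in>A \<inter> S. v x z) - (\<Sum>x\<in>A - S. v x z)))\<^sup>2)"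
  using assms
proof (induction A)
  case (insert a A)
  then obtain S where S: "(\<Sum>x\<in>A. \<Sum>z\<in>B. (cmod (v x z))\<^sup>2)
      \<le> (\<Sum>z\<in>B. (cmod ((\<Sum>x\<in>A \<inter> S. v x z) - (\<Sum>x\<in>A - S. v x z)))\<^sup>2)" by blast
  define w where "w z = (\<Sum>x\<in>A \<inter> S. v x z) - (\<Sum>x\<in>A - S. v x z)" for z
  have "A \<inter> insert a S = A \<inter> S" "A - insert a S = A - S" "A \<inter> (S - {a}) = A \<inter> S" "A - (S - {a}) = A - S"
    using insert.hyps by auto
  then have plus: "(\<Sum>x\<in>insert a A \<inter> insert a S. v x z) - (\<Sum>x\<in>insert a A - insert a S. v x z) = w z + v a z"
    and minus: "(\<Sum>x\<in>insert a A \<inter> (S - {a}). v x z) - (\<Sum>x\<in>insert a A - (S - {a}). v x z) = w z - v a z" for z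
    using insert.hyps by (simp_all add: w_def insert_Diff_if)
  have "(\<Sum>z\<in>B. (cmod (w z + v a z))\<^sup>2) + (\<Sum>z\<in>B. (cmod (w z - v a z))\<^sup>2)
     = 2 * (\<Sum>z\<in>B. (cmod (w z))\<^sup>2) + 2 * (\<Sum>z\<in>B. (cmod (v a z))\<^sup>2)"
    by (rule parallelogram_sum_cmod)
  then consider "(\<Sum>z\<in>B. (cmod (w z))\<^sup>2) + (\<Sum>z\<in>B. (cmod (v a z))\<^sup>2) \<le> (\<Sum>z\<in>B. (cmod (w z + v a z))\<^sup>2)"
    | "(\<Sum>z\<in>B. (cmod (w z))\<^sup>2) + (\<Sum>z\<in>B. (cmod (v a z))\<^sup>2) \<le> (\<Sum>z\<in>B. (cmod (w z - v a z))\<^sup>2)"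
    by linarith
  then show ?case
  proof cases
    case 1
    then show ?thesis
      using S insert.hyps unfolding plus[symmetric] by (intro exI[of _ "insert a S"]) (simp add: w_def)
  next
    case 2
    then show ?thesis
      using S insert.hyps unfolding minus[symmetric] by (intro exI[of _ "S - {a}"]) (simp add: w_def)
  qed
qed simp

text \<open>Gaussian elimination: an unknown with nonzero coefficient in one equation is solved for
  and substituted into the others, which costs one equation and one unknown.\<close>

lemma underdetermined_system_nontrivial_solution:
  fixes u :: "'a \<Rightarrow> 'b \<Rightarrow> complex"
  assumes "finite N" "finite A" "card N < card A"
  shows "\<exists>c. (\<exists>x\<in>A. c x \<noteq> 0) \<and> (\<forall>y\<in>N. (\<Sum>x\<in>A. c x * u x y) = 0)"
  using assms
proof (induction N arbitrary: A u)
  case empty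
  then have "A \<noteq> {}" by auto
  then show ?case by (intro exI[of _ "\<lambda>_. 1"]) auto
next
  case (insert y N)
  show ?case
  proof (cases "\<forall>x\<in>A. u x y = 0")
    case True
    obtain c where c: "\<exists>x\<in>A. c x \<noteq> 0" "\<forall>y\<in>N. (\<Sum>x\<in>A. c x * u x y) = 0"
      using insert.IH[of A u] insert.prems insert.hyps by auto
    have "(\<Sum>x\<in>A. c x * u x y) = 0" using True by (intro sum.neutral) auto
    then show ?thesis using c by blast
  next
    case False
    then obtain x0 where x0: "x0 \<in> A" "u x0 y \<noteq> 0" by blast
    define A' where "A' = A - {x0}"
    have A': "finite A'" "x0 \<notin> A'" "A = insert x0 A'" "card N < card A'"
      using insert.prems insert.hyps x0 by (auto simp: A'_def)
    obtain c' where c': "\<exists>x\<in>A'. c' x \<noteq> 0"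
      "\<forall>z\<in>N. (\<Sum>x\<in>A'. c' x * (u x z - u x y / u x0 y * u x0 z)) = 0"
      using insert.IH[OF A'(1) A'(4), of "\<lambda>x z. u x z - u x y / u x0 y * u x0 z"] by blast
    \<comment> \<open>The pivot value solves the equation at \<open>y\<close>; the reduced
      coefficients in \<open>sumc\<close> vanish identically there.\<close>
    define c where "c = c'(x0 := - (\<Sum>x\<in>A'. c' x * u x y) / u x0 y)"
    have sumc: "(\<Sum>x\<in>A. c x * u x z) = (\<Sum>x\<in>A'. c' x * (u x z - u x y / u x0 y * u x0 z))" for z
    proof -
      have "(\<Sum>x\<in>A. c x * u x z) = c x0 * u x0 z + (\<Sum>x\<in>A'. c x * u x z)"
        using A' by simp
      also have "(\<Sum>x\<in>A'. c x * u x z) = (\<Sum>x\<in>A'. c' x * u x z)"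
        using A' by (intro sum.cong) (auto simp: c_def)
      also have "c x0 * u x0 z = - (\<Sum>x\<in>A'. c' x * (u x y / u x0 y * u x0 z))"
        by (simp add: c_def sum_distrib_right sum_divide_distrib mult.assoc)
      finally show ?thesis by (simp add: right_diff_distrib sum_subtractf)
    qed
    have "(\<Sum>x\<in>A. c x * u x y) = 0"
      unfolding sumc using x0 by (intro sum.neutral) auto
    moreover have "\<exists>x\<in>A. c x \<noteq> 0"
      using c'(1) A' by (auto simp: c_def)
    ultimately show ?thesis using c'(2) sumc by (intro exI[of _ c]) auto
  qed
qed

section \<open>Square-summable functions\<close>

text \<open>Finite partial sums decide both membership and norm, so inequalities for
  \<open>L2_set\<close> pass to \<open>l2 X\<close> without separate summability arguments.\<close>

lemma l2_bounded_finite_sumsI: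
  assumes supp: "\<And>x. x \<notin> X \<Longrightarrow> f x = 0"
    and bound: "\<And>F. finite F \<Longrightarrow> F \<subseteq> X \<Longrightarrow> L2_set (\<lambda>x. cmod (f x)) F \<le> c"
  shows "f \<in> l2 X" "l2_norm X f \<le> c"
proof -
  have c: "0 \<le> c" using bound[of "{}"] by simp
  have b: "(\<Sum>x\<in>F. (cmod (f x))\<^sup>2) \<le> c\<^sup>2" if "finite F" "F \<subseteq> X" for F
    using bound[OF that] unfolding L2_set_def by (rule sqrt_le_D)
  have s: "(\<lambda>x. (cmod (f x))\<^sup>2) summable_on X"
  proof (rule nonneg_bdd_above_summable_on)
    show "bdd_above (sum (\<lambda>x. (cmod (f x))\<^sup>2) ` {F. F \<subseteq> X \<and> finite F})"
      using b by (intro bdd_aboveI[of _ "c\<^sup>2"]) auto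
  qed simp
  then show "f \<in> l2 X" using supp by (simp add: l2_def)
  have "infsum (\<lambda>x. (cmod (f x))\<^sup>2) X \<le> c\<^sup>2"
    using s b by (rule infsum_le_finite_sums)
  then show "l2_norm X f \<le> c" using c by (simp add: l2_norm_def real_le_lsqrt)
qed

lemma l2_norm_nonneg [simp]: "0 \<le> l2_norm X f"
  by (simp add: l2_norm_def infsum_nonneg)

lemma l2_norm_pos: "l2_norm X f \<noteq> 0 \<Longrightarrow> 0 < l2_norm X f"
  using l2_norm_nonneg[of X f] by linarith

lemma l2_norm_power2: "(l2_norm X f)\<^sup>2 = infsum (\<lambda>x. (cmod (f x))\<^sup>2) X"
  by (simp add: l2_norm_def infsum_nonneg)

lemma l2_outside: "f \<in> l2 X \<Longrightarrow> x \<notin> X \<Longrightarrow> f x = 0"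
  by (simp add: l2_def)

lemma sum_le_l2_norm:
  assumes "f \<in> l2 X" "finite F" "F \<subseteq> X"
  shows "(\<Sum>x\<in>F. (cmod (f x))\<^sup>2) \<le> (l2_norm X f)\<^sup>2"
  unfolding l2_norm_power2 using assms by (intro finite_sum_le_infsum) (auto simp: l2_def)

lemma L2_set_le_l2_norm:
  assumes "f \<in> l2 X" "finite F" "F \<subseteq> X"
  shows "L2_set (\<lambda>x. cmod (f x)) F \<le> l2_norm X f"
  using sum_le_l2_norm[OF assms] by (simp add: L2_set_def real_le_lsqrt sum_nonneg)

lemma cmod_le_l2_norm:
  assumes "f \<in> l2 X"
  shows "cmod (f x) \<le> l2_norm X f"
proof (cases "x \<in> X")
  case True
  then show ?thesis using L2_set_le_l2_norm[OF assms, of "{x}"] by simp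
next
  case False
  then show ?thesis using assms by (simp add: l2_outside)
qed

lemma l2_norm_approx:
  assumes "f \<in> l2 X" "e > 0"
  shows "\<exists>F. finite F \<and> F \<subseteq> X \<and> (l2_norm X f)\<^sup>2 - e \<le> (\<Sum>x\<in>F. (cmod (f x))\<^sup>2)"
proof -
  have "(\<lambda>x. (cmod (f x))\<^sup>2) summable_on X" using assms by (simp add: l2_def)
  from infsum_finite_approximation[OF this assms(2)] show ?thesis
    unfolding l2_norm_power2 by (auto simp: dist_real_def abs_le_iff algebra_simps)
qed

lemma l2_norm_less_finite:
  assumes "f \<in> l2 X" "c < l2_norm X f"
  shows "\<exists>F. finite F \<and> F \<subseteq> X \<and> c < L2_set (\<lambda>x. cmod (f x)) F"
proof (rule ccontr)
  assume "\<not> ?thesis"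
  then have "l2_norm X f \<le> c"
    using assms(1) by (intro l2_bounded_finite_sumsI(2)) (auto simp: l2_outside not_less)
  then show False using assms(2) by simp
qed

lemma l2_zero [simp]: "(\<lambda>_. 0) \<in> l2 X"
  by (simp add: l2_def)

lemma l2_norm_zero [simp]: "l2_norm X (\<lambda>_. 0) = 0"
  by (simp add: l2_norm_def)

lemma l2_norm_eq_0:
  assumes "f \<in> l2 X" "l2_norm X f = 0"
  shows "f = (\<lambda>_. 0)"
  using cmod_le_l2_norm[OF assms(1)] assms(2) by (intro ext) simp

lemma
  assumes f: "f \<in> l2 X" and g: "g \<in> l2 X"
  shows l2_add: "(\<lambda>x. f x + g x) \<in> l2 X"
    and l2_norm_triangle: "l2_norm X (\<lambda>x. f x + g x) \<le> l2_norm X f + l2_norm X g"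
proof -
  have "L2_set (\<lambda>x. cmod (f x + g x)) F \<le> l2_norm X f + l2_norm X g" if F: "finite F" "F \<subseteq> X" for F
  proof -
    have "L2_set (\<lambda>x. cmod (f x + g x)) F \<le> L2_set (\<lambda>x. cmod (f x) + cmod (g x)) F"
      by (intro L2_set_mono) (auto intro: norm_triangle_ineq)
    also have "\<dots> \<le> L2_set (\<lambda>x. cmod (f x)) F + L2_set (\<lambda>x. cmod (g x)) F"
      by (rule L2_set_triangle_ineq)
    also have "\<dots> \<le> l2_norm X f + l2_norm X g"
      using F f g by (intro add_mono L2_set_le_l2_norm)
    finally show ?thesis .
  qed
  then show "(\<lambda>x. f x + g x) \<in> l2 X" "l2_norm X (\<lambda>x. f x + g x) \<le> l2_norm X f + l2_norm X g"
    using l2_bounded_finite_sumsI[of X "\<lambda>x. f x + g x" "l2_norm X f + l2_norm X g"] f g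
    by (auto simp: l2_outside)
qed

lemma l2_norm_cmult: "l2_norm X (\<lambda>x. c * f x) = cmod c * l2_norm X f"
  by (simp add: l2_norm_def norm_mult power_mult_distrib infsum_cmult_right' real_sqrt_mult)

lemma l2_cmult: "f \<in> l2 X \<Longrightarrow> (\<lambda>x. c * f x) \<in> l2 X"
  by (auto simp: l2_def norm_mult power_mult_distrib intro: summable_on_cmult_right)

lemma l2_diff:
  assumes "f \<in> l2 X" "g \<in> l2 X"
  shows "(\<lambda>x. f x - g x) \<in> l2 X"
  using l2_add[OF assms(1) l2_cmult[OF assms(2), of "-1"]] by simp

lemma l2_norm_triangle_diff:
  assumes "f \<in> l2 X" "g \<in> l2 X"
  shows "l2_norm X (\<lambda>x. f x - g x) \<le> l2_norm X f + l2_norm X g"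
  using l2_norm_triangle[OF assms(1) l2_cmult[OF assms(2), of "-1"]] l2_norm_cmult[of X "-1" g] by simp

lemma l2_sum:
  assumes "\<And>i. i \<in> I \<Longrightarrow> f i \<in> l2 X"
  shows "(\<lambda>x. \<Sum>i\<in>I. f i x) \<in> l2 X"
  using assms by (induction I rule: infinite_finite_induct) (auto intro: l2_add)

lemma
  assumes f: "f \<in> l2 X" and g: "\<And>x. cmod (g x) \<le> cmod (f x)"
  shows l2_dominated: "g \<in> l2 X" and l2_norm_mono: "l2_norm X g \<le> l2_norm X f"
proof -
  have "L2_set (\<lambda>x. cmod (g x)) F \<le> l2_norm X f" if F: "finite F" "F \<subseteq> X" for F
    using L2_set_mono[of F "\<lambda>x. cmod (g x)" "\<lambda>x. cmod (f x)"] g L2_set_le_l2_norm[OF f F] by force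
  moreover have "g x = 0" if "x \<notin> X" for x
    using g[of x] l2_outside[OF f that] by simp
  ultimately show "g \<in> l2 X" "l2_norm X g \<le> l2_norm X f"
    using l2_bounded_finite_sumsI[of X g] by auto
qed

lemma l2_proj: "f \<in> l2 X \<Longrightarrow> proj A f \<in> l2 X"
  by (erule l2_dominated) (simp add: proj_def)

lemma l2_norm_proj_le: "f \<in> l2 X \<Longrightarrow> l2_norm X (proj A f) \<le> l2_norm X f"
  by (erule l2_norm_mono) (simp add: proj_def)

lemma proj_linear: "proj A (\<lambda>x. c * f x + g x) = (\<lambda>x. c * proj A f x + proj A g x)"
  by (auto simp: proj_def)

lemma proj_l2_self: "f \<in> l2 X \<Longrightarrow> proj X f = f"
  by (auto simp: proj_def l2_outside)

lemma l2_proj_finite: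
  assumes "finite F" "F \<subseteq> X"
  shows "proj F f \<in> l2 X" "l2_norm X (proj F f) = L2_set (\<lambda>x. cmod (f x)) F"
proof -
  have "L2_set (\<lambda>x. cmod (proj F f x)) E \<le> L2_set (\<lambda>x. cmod (f x)) F" if "finite E" "E \<subseteq> X" for E
  proof -
    have "(\<Sum>x\<in>E. (cmod (proj F f x))\<^sup>2) = (\<Sum>x\<in>E \<inter> F. (cmod (f x))\<^sup>2)"
      using that by (intro sum.mono_neutral_cong_right) (auto simp: proj_def)
    also have "\<dots> \<le> (\<Sum>x\<in>F. (cmod (f x))\<^sup>2)"
      using assms by (intro sum_mono2) auto
    finally show ?thesis by (simp add: L2_set_def)
  qed
  moreover have "proj F f x = 0" if "x \<notin> X" for x
    using that assms by (auto simp: proj_def)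
  ultimately show 1: "proj F f \<in> l2 X" and "l2_norm X (proj F f) = L2_set (\<lambda>x. cmod (f x)) F"
    using l2_bounded_finite_sumsI[of X "proj F f" "L2_set (\<lambda>x. cmod (f x)) F"]
      L2_set_le_l2_norm[OF _ assms, of "proj F f"]
      L2_set_cong[of F F "\<lambda>x. cmod (proj F f x)" "\<lambda>x. cmod (f x)"]
    by (auto simp: proj_def)
qed

lemma l2_finite_approx:
  assumes "f \<in> l2 X" "e > 0"
  shows "\<exists>F. finite F \<and> F \<subseteq> X \<and> l2_norm X (\<lambda>x. f x - proj F f x) \<le> e"
proof -
  obtain F where F: "finite F" "F \<subseteq> X" "(l2_norm X f)\<^sup>2 - e\<^sup>2 \<le> (\<Sum>x\<in>F. (cmod (f x))\<^sup>2)"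
    using l2_norm_approx[OF assms(1), of "e\<^sup>2"] assms(2) by auto
  have "L2_set (\<lambda>x. cmod (f x - proj F f x)) E \<le> e" if E: "finite E" "E \<subseteq> X" for E
  proof -
    have "(\<Sum>x\<in>E. (cmod (f x - proj F f x))\<^sup>2) = (\<Sum>x\<in>E - F. (cmod (f x))\<^sup>2)"
      using E by (intro sum.mono_neutral_cong_right) (auto simp: proj_def)
    also have "\<dots> = (\<Sum>x\<in>E \<union> F. (cmod (f x))\<^sup>2) - (\<Sum>x\<in>F. (cmod (f x))\<^sup>2)"
      using E F(1) sum.subset_diff[of F "E \<union> F" "\<lambda>x. (cmod (f x))\<^sup>2"] by (simp add: Un_Diff)
    also have "\<dots> \<le> e\<^sup>2"
      using sum_le_l2_norm[OF assms(1), of "E \<union> F"] E F by simp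
    finally show ?thesis using assms(2) by (simp add: L2_set_def real_le_lsqrt sum_nonneg)
  qed
  then show ?thesis
    using F(1,2) assms(1) l2_bounded_finite_sumsI(2)[of X "\<lambda>x. f x - proj F f x" e]
    by (intro exI[of _ F]) (auto simp: l2_outside proj_def)
qed

section \<open>Coordinate vectors and the inner product\<close>

definition ket :: "'a \<Rightarrow> 'a \<Rightarrow> complex" where
  "ket x = (\<lambda>z. if z = x then 1 else 0)"

lemma ket_l2 [simp]: "x \<in> X \<Longrightarrow> ket x \<in> l2 X"
  and l2_norm_ket [simp]: "x \<in> X \<Longrightarrow> l2_norm X (ket x) = 1"
proof -
  assume x: "x \<in> X"
  have "ket x = proj {x} (\<lambda>_. 1)" by (auto simp: ket_def proj_def)
  then show "ket x \<in> l2 X" "l2_norm X (ket x) = 1"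
    using l2_proj_finite[of "{x}" X "\<lambda>_. 1"] x by auto
qed

lemma proj_singleton: "proj {x} f = (\<lambda>z. f x * ket x z)"
  by (auto simp: proj_def ket_def)

lemma l2_inner_summable:
  assumes "f \<in> l2 X" "g \<in> l2 X"
  shows "(\<lambda>x. f x * cnj (g x)) summable_on X"
    and "(\<lambda>x. cmod (f x * cnj (g x))) summable_on X"
proof -
  have "(\<lambda>x. (cmod (f x))\<^sup>2 + (cmod (g x))\<^sup>2) summable_on X"
    using assms by (intro summable_on_add) (auto simp: l2_def)
  then show 1: "(\<lambda>x. cmod (f x * cnj (g x))) summable_on X"
  proof (rule summable_on_comparison_test)
    fix x
    have "2 * (cmod (f x) * cmod (g x)) \<le> (cmod (f x))\<^sup>2 + (cmod (g x))\<^sup>2"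
      using sum_squares_bound[of "cmod (f x)" "cmod (g x)"] by simp
    moreover have "0 \<le> cmod (f x) * cmod (g x)" by simp
    ultimately show "cmod (f x * cnj (g x)) \<le> (cmod (f x))\<^sup>2 + (cmod (g x))\<^sup>2"
      unfolding norm_mult complex_mod_cnj by linarith
  qed simp
  then show "(\<lambda>x. f x * cnj (g x)) summable_on X" by (rule abs_summable_summable)
qed

lemma l2_Cauchy_Schwarz:
  assumes "f \<in> l2 X" "g \<in> l2 X"
  shows "cmod (l2_inner X f g) \<le> l2_norm X f * l2_norm X g"
proof -
  have "cmod (l2_inner X f g) \<le> infsum (\<lambda>x. cmod (f x * cnj (g x))) X"
    unfolding l2_inner_def using l2_inner_summable[OF assms] by (intro norm_infsum_bound) simp
  also have "\<dots> \<le> l2_norm X f * l2_norm X g"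
  proof (rule infsum_le_finite_sums)
    fix F assume F: "finite F" "F \<subseteq> X"
    have "(\<Sum>x\<in>F. cmod (f x * cnj (g x))) \<le> L2_set (\<lambda>x. cmod (f x)) F * L2_set (\<lambda>x. cmod (g x)) F"
      using L2_set_mult_ineq[of "\<lambda>x. cmod (f x)" "\<lambda>x. cmod (g x)" F] by (simp add: norm_mult)
    also have "\<dots> \<le> l2_norm X f * l2_norm X g"
      using assms F by (intro mult_mono L2_set_le_l2_norm) auto
    finally show "(\<Sum>x\<in>F. cmod (f x * cnj (g x))) \<le> l2_norm X f * l2_norm X g" .
  qed (use l2_inner_summable[OF assms] in simp)
  finally show ?thesis .
qed

lemma l2_inner_linear:
  assumes "f \<in> l2 X" "g \<in> l2 X" "k \<in> l2 X"
  shows "l2_inner X (\<lambda>x. c * f x + g x) k = c * l2_inner X f k + l2_inner X g k"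
proof -
  have "l2_inner X (\<lambda>x. c * f x + g x) k = infsum (\<lambda>x. c * (f x * cnj (k x)) + g x * cnj (k x)) X"
    unfolding l2_inner_def by (intro infsum_cong) (simp add: algebra_simps)
  also have "\<dots> = infsum (\<lambda>x. c * (f x * cnj (k x))) X + infsum (\<lambda>x. g x * cnj (k x)) X"
    using assms by (intro infsum_add summable_on_cmult_right l2_inner_summable)
  finally show ?thesis by (simp add: infsum_cmult_right' l2_inner_def)
qed

lemma l2_inner_cnj: "l2_inner X f g = cnj (l2_inner X g f)"
  by (simp add: l2_inner_def infsum_cnj[symmetric] mult.commute del: infsum_cnj)

lemma l2_inner_cmult: "l2_inner X (\<lambda>x. c * f x) k = c * l2_inner X f k"
  by (simp add: l2_inner_def mult.assoc infsum_cmult_right')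

lemma l2_inner_cmult_right: "l2_inner X f (\<lambda>x. c * k x) = cnj c * l2_inner X f k"
  by (simp add: l2_inner_cnj[of X f] l2_inner_cmult)

lemma l2_inner_add:
  assumes "f \<in> l2 X" "g \<in> l2 X" "k \<in> l2 X"
  shows "l2_inner X (\<lambda>x. f x + g x) k = l2_inner X f k + l2_inner X g k"
  using l2_inner_linear[OF assms, of 1] by simp

lemma l2_inner_add_right:
  assumes "f \<in> l2 X" "g \<in> l2 X" "k \<in> l2 X"
  shows "l2_inner X k (\<lambda>x. f x + g x) = l2_inner X k f + l2_inner X k g"
  using assms by (simp add: l2_inner_cnj[of X k] l2_inner_add)

lemma l2_inner_diff:
  assumes "f \<in> l2 X" "g \<in> l2 X" "k \<in> l2 X"
  shows "l2_inner X (\<lambda>x. f x - g x) k = l2_inner X f k - l2_inner X g k"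
  using l2_inner_linear[OF assms(2,1,3), of "-1"] by simp

lemma l2_inner_self:
  assumes "f \<in> l2 X"
  shows "l2_inner X f f = complex_of_real ((l2_norm X f)\<^sup>2)"
proof -
  have "l2_inner X f f = infsum (\<lambda>x. complex_of_real ((cmod (f x))\<^sup>2)) X"
    unfolding l2_inner_def by (intro infsum_cong) (metis complex_norm_square)
  also have "\<dots> = complex_of_real (infsum (\<lambda>x. (cmod (f x))\<^sup>2) X)"
    using assms by (intro infsumI has_sum_of_real has_sum_infsum) (simp add: l2_def)
  finally show ?thesis by (simp add: l2_norm_power2 del: of_real_power)
qed

lemma l2_inner_ket: "x \<in> X \<Longrightarrow> l2_inner X f (ket x) = f x"
proof -
  assume x: "x \<in> X"
  have "l2_inner X f (ket x) = infsum (\<lambda>z. f z * cnj (ket x z)) {x}"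
    unfolding l2_inner_def using x by (intro infsum_cong_neutral) (auto simp: ket_def)
  then show ?thesis by (simp add: ket_def)
qed

text \<open>Taking \<open>g = f\<close> and cancelling one factor suffices; this form moves norm
  estimates across the adjoint.\<close>

lemma l2_norm_le_inner_bound:
  assumes f: "f \<in> l2 X" and c: "0 \<le> c"
    and bound: "\<And>g. g \<in> l2 X \<Longrightarrow> cmod (l2_inner X f g) \<le> c * l2_norm X g"
  shows "l2_norm X f \<le> c"
proof (cases "l2_norm X f = 0")
  case False
  have "(l2_norm X f)\<^sup>2 \<le> c * l2_norm X f"
    using bound[OF f] f by (simp add: l2_inner_self norm_power del: of_real_power)
  moreover have "0 < l2_norm X f" using False by (rule l2_norm_pos)
  ultimately show ?thesis by (simp add: power2_eq_square)
qed (use c in simp)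

lemma l2_norm_Pythagoras:
  assumes "f \<in> l2 X" "g \<in> l2 X" "l2_inner X f g = 0"
  shows "(l2_norm X (\<lambda>x. f x + g x))\<^sup>2 = (l2_norm X f)\<^sup>2 + (l2_norm X g)\<^sup>2"
proof -
  have "l2_inner X g f = 0" using assms(3) l2_inner_cnj[of X g f] by simp
  then have "l2_inner X (\<lambda>x. f x + g x) (\<lambda>x. f x + g x) = l2_inner X f f + l2_inner X g g"
    using assms by (simp add: l2_inner_add l2_inner_add_right l2_add)
  then have "complex_of_real ((l2_norm X (\<lambda>x. f x + g x))\<^sup>2) = complex_of_real ((l2_norm X f)\<^sup>2 + (l2_norm X g)\<^sup>2)"
    using assms(1,2) by (simp add: l2_inner_self l2_add del: of_real_power)
  then show ?thesis unfolding of_real_eq_iff .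
qed

section \<open>Bounded and quasi-local operators\<close>

lemma bops_l2: "a \<in> bops X \<Longrightarrow> f \<in> l2 X \<Longrightarrow> a f \<in> l2 X"
  by (simp add: bops_def)

lemma bops_linear:
  "a \<in> bops X \<Longrightarrow> f \<in> l2 X \<Longrightarrow> g \<in> l2 X \<Longrightarrow> a (\<lambda>x. c * f x + g x) = (\<lambda>x. c * a f x + a g x)"
  by (simp add: bops_def)

lemma bops_outside: "a \<in> bops X \<Longrightarrow> f \<notin> l2 X \<Longrightarrow> a f = (\<lambda>_. 0)"
  by (simp add: bops_def)

lemma bops_bound:
  assumes "a \<in> bops X"
  obtains K where "0 \<le> K" "\<And>f. f \<in> l2 X \<Longrightarrow> l2_norm X (a f) \<le> K * l2_norm X f"
proof -
  obtain K where K: "\<And>f. f \<in> l2 X \<Longrightarrow> l2_norm X (a f) \<le> K * l2_norm X f"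
    using assms unfolding bops_def by blast
  have "l2_norm X (a f) \<le> \<bar>K\<bar> * l2_norm X f" if "f \<in> l2 X" for f
    using K[OF that] mult_right_mono[OF abs_ge_self l2_norm_nonneg] by (rule order_trans)
  then show ?thesis using that[of "\<bar>K\<bar>"] by simp
qed

lemma bopsI:
  assumes "\<And>f. f \<in> l2 X \<Longrightarrow> a f \<in> l2 X"
    and "\<And>f g c. f \<in> l2 X \<Longrightarrow> g \<in> l2 X \<Longrightarrow> a (\<lambda>x. c * f x + g x) = (\<lambda>x. c * a f x + a g x)"
    and "\<And>f. f \<in> l2 X \<Longrightarrow> l2_norm X (a f) \<le> K * l2_norm X f"
    and "\<And>f. f \<notin> l2 X \<Longrightarrow> a f = (\<lambda>_. 0)"
  shows "a \<in> bops X"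
  using assms unfolding bops_def by blast

lemma bops_eqI:
  assumes "a \<in> bops X" "b \<in> bops X" "\<And>f. f \<in> l2 X \<Longrightarrow> a f = b f"
  shows "a = b"
proof
  fix f show "a f = b f"
    using assms by (cases "f \<in> l2 X") (auto simp: bops_outside)
qed

lemma bops_add:
  "a \<in> bops X \<Longrightarrow> f \<in> l2 X \<Longrightarrow> g \<in> l2 X \<Longrightarrow> a (\<lambda>x. f x + g x) = (\<lambda>x. a f x + a g x)"
  using bops_linear[of a X f g 1] by simp

lemma bops_zero: "a \<in> bops X \<Longrightarrow> a (\<lambda>_. 0) = (\<lambda>_. 0)"
  using bops_linear[of a X "\<lambda>_. 0" "\<lambda>_. 0" "1"] by (auto simp: fun_eq_iff)

lemma bops_cmult:
  "a \<in> bops X \<Longrightarrow> f \<in> l2 X \<Longrightarrow> a (\<lambda>x. c * f x) = (\<lambda>x. c * a f x)"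
  using bops_linear[of a X f "\<lambda>_. 0" c] by (simp add: bops_zero)

lemma bops_diff:
  "a \<in> bops X \<Longrightarrow> f \<in> l2 X \<Longrightarrow> g \<in> l2 X \<Longrightarrow> a (\<lambda>x. f x - g x) = (\<lambda>x. a f x - a g x)"
  using bops_linear[of a X g f "-1"] by simp

lemma bops_sum:
  assumes "a \<in> bops X" "\<And>i. i \<in> I \<Longrightarrow> f i \<in> l2 X"
  shows "a (\<lambda>x. \<Sum>i\<in>I. f i x) = (\<lambda>x. \<Sum>i\<in>I. a (f i) x)"
  using assms(2)
proof (induction I rule: infinite_finite_induct)
  case (insert i I)
  then have "(\<lambda>x. \<Sum>i\<in>I. f i x) \<in> l2 X" by (intro l2_sum) simp
  then show ?case using insert bops_add[OF assms(1), of "f i"] by simp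
qed (use assms(1) in \<open>auto simp: bops_zero\<close>)

lemma bops_comp:
  assumes "a \<in> bops X" "b \<in> bops X"
  shows "a \<circ> b \<in> bops X"
proof -
  obtain K where K: "0 \<le> K" "\<And>f. f \<in> l2 X \<Longrightarrow> l2_norm X (a f) \<le> K * l2_norm X f"
    using bops_bound[OF assms(1)] by blast
  obtain L where L: "0 \<le> L" "\<And>f. f \<in> l2 X \<Longrightarrow> l2_norm X (b f) \<le> L * l2_norm X f"
    using bops_bound[OF assms(2)] by blast
  show ?thesis
  proof (rule bopsI[where K = "K * L"])
    fix f assume f: "f \<in> l2 X"
    have "l2_norm X (a (b f)) \<le> K * l2_norm X (b f)"
      using K(2) bops_l2[OF assms(2) f] by blast
    also have "\<dots> \<le> K * (L * l2_norm X f)" using K(1) L(2)[OF f] by (intro mult_left_mono)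
    finally show "l2_norm X ((a \<circ> b) f) \<le> K * L * l2_norm X f" by (simp add: mult.assoc)
  qed (use assms in \<open>auto simp: bops_l2 bops_linear bops_outside bops_zero\<close>)
qed

lemma bops_lincomb:
  assumes "a \<in> bops X" "b \<in> bops X"
  shows "(\<lambda>f x. c * a f x + b f x) \<in> bops X"
proof -
  obtain K where K: "\<And>f. f \<in> l2 X \<Longrightarrow> l2_norm X (a f) \<le> K * l2_norm X f"
    using bops_bound[OF assms(1)] by blast
  obtain L where L: "\<And>f. f \<in> l2 X \<Longrightarrow> l2_norm X (b f) \<le> L * l2_norm X f"
    using bops_bound[OF assms(2)] by blast
  show ?thesis
  proof (rule bopsI[where K = "cmod c * K + L"])
    fix f assume f: "f \<in> l2 X"
    have "l2_norm X (\<lambda>x. c * a f x + b f x) \<le> cmod c * l2_norm X (a f) + l2_norm X (b f)"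
      using l2_norm_triangle[OF l2_cmult[OF bops_l2[OF assms(1) f]] bops_l2[OF assms(2) f]]
      by (simp add: l2_norm_cmult)
    also have "\<dots> \<le> cmod c * (K * l2_norm X f) + L * l2_norm X f"
      using K[OF f] L[OF f] by (intro add_mono mult_left_mono) auto
    finally show "l2_norm X (\<lambda>x. c * a f x + b f x) \<le> (cmod c * K + L) * l2_norm X f"
      by (simp add: algebra_simps)
    fix g k
    assume "g \<in> l2 X"
    with f show "(\<lambda>x. c * a (\<lambda>x. k * f x + g x) x + b (\<lambda>x. k * f x + g x) x)
        = (\<lambda>x. k * (c * a f x + b f x) + (c * a g x + b g x))"
      using assms by (simp add: bops_linear) (simp add: algebra_simps)
  qed (use assms in \<open>auto simp: bops_l2 bops_outside l2_add l2_cmult\<close>)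
qed

text \<open>\<open>proj S\<close> may be nonzero on functions that are not square-summable, whereas
  members of \<open>bops X\<close> vanish there; this is its extensional version, an actual element
  of the algebra.\<close>

definition chi :: "'a set \<Rightarrow> 'a set \<Rightarrow> 'a op" where
  "chi X S f = (if f \<in> l2 X then proj S f else (\<lambda>_. 0))"

lemma chi_apply: "f \<in> l2 X \<Longrightarrow> chi X S f = proj S f"
  by (simp add: chi_def)

lemma chi_bops: "chi X S \<in> bops X"
  by (rule bopsI[where K = 1])
    (auto simp: chi_def l2_proj l2_norm_proj_le proj_linear l2_add l2_cmult)

lemma l2_inner_proj: "l2_inner X (proj A f) g = l2_inner X f (proj A g)"
  unfolding l2_inner_def by (intro infsum_cong) (simp add: proj_def)

section \<open>Adjoints of bounded operators\<close>

lemma is_adjoint_unique: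
  assumes "b \<in> bops X" "b' \<in> bops X" "is_adjoint X a b" "is_adjoint X a b'"
  shows "b = b'"
proof (rule bops_eqI[OF assms(1,2)], rule ext)
  fix g x assume g: "g \<in> l2 X"
  show "b g x = b' g x"
  proof (cases "x \<in> X")
    case True
    then have "l2_inner X (ket x) (b g) = l2_inner X (ket x) (b' g)"
      using assms(3,4) g by (simp add: is_adjoint_def)
    then show ?thesis
      using True by (simp add: l2_inner_cnj[of X "ket x"] l2_inner_ket)
  next
    case False
    then show ?thesis using assms(1,2) g by (metis bops_l2 l2_outside)
  qed
qed

text \<open>Testing the adjoint relation on \<open>ket x\<close> forces the coordinates of
  \<open>b g\<close>, so the adjoint is built from its matrix. The relation holds on finitely
  supported vectors; this yields boundedness, and then approximation gives the general case.\<close>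

lemma bops_has_adjoint:
  assumes a: "a \<in> bops X"
  shows "\<exists>b\<in>bops X. is_adjoint X a b"
proof -
  obtain K where K: "0 \<le> K" "\<And>f. f \<in> l2 X \<Longrightarrow> l2_norm X (a f) \<le> K * l2_norm X f"
    using bops_bound[OF a] by blast
  define b where "b g = (\<lambda>x. if g \<in> l2 X \<and> x \<in> X then l2_inner X g (a (ket x)) else 0)" for g
  have fin: "l2_inner X (a (proj F f)) g = (\<Sum>x\<in>F. f x * cnj (b g x))"
    if F: "finite F" "F \<subseteq> X" and g: "g \<in> l2 X" for F f g
    using F
  proof (induction F)
    case empty
    have "proj {} f = (\<lambda>_. 0)" by (simp add: proj_def)
    then show ?case by (simp add: bops_zero[OF a] l2_inner_def)
  next
    case (insert x F)
    have e: "proj (insert x F) f = (\<lambda>z. f x * ket x z + proj F f z)"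
      using insert.hyps by (auto simp: proj_def ket_def)
    have "x \<in> X" "proj F f \<in> l2 X" using insert l2_proj_finite by auto
    then have "l2_inner X (a (proj (insert x F) f)) g
        = f x * l2_inner X (a (ket x)) g + l2_inner X (a (proj F f)) g"
      unfolding e using a g by (simp add: bops_linear l2_inner_linear bops_l2)
    also have "l2_inner X (a (ket x)) g = cnj (b g x)"
      using \<open>x \<in> X\<close> g l2_inner_cnj[of X "a (ket x)" g] by (simp add: b_def)
    finally show ?case using insert by simp
  qed
  have bnd: "L2_set (\<lambda>x. cmod (b g x)) F \<le> K * l2_norm X g"
    if F: "finite F" "F \<subseteq> X" and g: "g \<in> l2 X" for F g
  proof -
    \<comment> \<open>Testing against the truncation of \<open>b g\<close> itself gives
      \<open>s\<^sup>2 \<le> K * s * l2_norm X g\<close>, and one factor cancels.\<close>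
    define s where "s = L2_set (\<lambda>x. cmod (b g x)) F"
    have pF: "proj F (b g) \<in> l2 X" "l2_norm X (proj F (b g)) = s"
      using l2_proj_finite[OF F, of "b g"] by (auto simp: s_def)
    have "s\<^sup>2 = (\<Sum>x\<in>F. (cmod (b g x))\<^sup>2)" by (simp add: s_def L2_set_def sum_nonneg)
    also have "complex_of_real \<dots> = l2_inner X (a (proj F (b g))) g"
      unfolding fin[OF F g] by (simp add: complex_norm_square del: of_real_power)
    finally have "s\<^sup>2 = cmod (l2_inner X (a (proj F (b g))) g)"
      by (metis abs_of_nonneg norm_of_real zero_le_power2)
    also have "\<dots> \<le> l2_norm X (a (proj F (b g))) * l2_norm X g"
      using pF g by (intro l2_Cauchy_Schwarz bops_l2[OF a])
    also have "\<dots> \<le> K * s * l2_norm X g"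
      using K(2)[OF pF(1)] pF(2) by (intro mult_right_mono) auto
    finally have "s * s \<le> s * (K * l2_norm X g)"
      by (simp add: power2_eq_square mult_ac)
    moreover have "0 \<le> s" by (simp add: s_def)
    ultimately have "s \<le> K * l2_norm X g"
      using K(1) by (cases "s = 0") auto
    then show ?thesis by (simp add: s_def)
  qed
  have b_l2: "b g \<in> l2 X" and b_norm: "l2_norm X (b g) \<le> K * l2_norm X g" if "g \<in> l2 X" for g
    using l2_bounded_finite_sumsI[of X "b g" "K * l2_norm X g"] bnd that by (auto simp: b_def)
  have adj: "is_adjoint X a b"
    unfolding is_adjoint_def
  proof (intro ballI)
    fix f g assume f: "f \<in> l2 X" and g: "g \<in> l2 X"
    \<comment> \<open>\<open>M\<close> dominates the sum of the coefficients of
      \<open>l2_norm X h\<close> in the two error terms; the added 1 keeps it positive for the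
      division in \<open>e / M\<close>.\<close>
    define M where "M = K * l2_norm X g + l2_norm X (b g) + 1"
    have M: "0 < M" using K(1) by (simp add: M_def add_nonneg_pos)
    have "cmod (l2_inner X (a f) g - l2_inner X f (b g)) \<le> 0 + e" if "e > 0" for e
    proof -
      obtain F where F: "finite F" "F \<subseteq> X" "l2_norm X (\<lambda>x. f x - proj F f x) \<le> e / M"
        using l2_finite_approx[OF f, of "e / M"] \<open>e > 0\<close> M by auto
      define h where "h = (\<lambda>x. f x - proj F f x)"
      have pF: "proj F f \<in> l2 X" and h: "h \<in> l2 X"
        using f by (auto simp: h_def l2_proj l2_diff)
      have "l2_inner X (proj F f) (b g) = infsum (\<lambda>x. f x * cnj (b g x)) F"
        unfolding l2_inner_def using F by (intro infsum_cong_neutral) (auto simp: proj_def)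
      then have "l2_inner X (a (proj F f)) g = l2_inner X (proj F f) (b g)"
        using fin[OF F(1,2) g] F(1) by simp
      moreover have "l2_inner X (a h) g = l2_inner X (a f) g - l2_inner X (a (proj F f)) g"
        using a f g pF by (simp add: h_def bops_diff l2_inner_diff bops_l2)
      moreover have "l2_inner X h (b g) = l2_inner X f (b g) - l2_inner X (proj F f) (b g)"
        using f pF b_l2[OF g] by (simp add: h_def l2_inner_diff)
      ultimately have "cmod (l2_inner X (a f) g - l2_inner X f (b g))
          = cmod (l2_inner X (a h) g - l2_inner X h (b g))" by simp
      also have "\<dots> \<le> l2_norm X (a h) * l2_norm X g + l2_norm X h * l2_norm X (b g)"
        using h g b_l2[OF g] bops_l2[OF a h]
        by (intro order_trans[OF norm_triangle_ineq4] add_mono l2_Cauchy_Schwarz)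
      also have "\<dots> \<le> (K * l2_norm X h) * l2_norm X g + l2_norm X h * l2_norm X (b g)"
        using K(2)[OF h] by (intro add_right_mono mult_right_mono) auto
      also have "\<dots> \<le> l2_norm X h * M" by (simp add: M_def algebra_simps)
      also have "\<dots> \<le> e / M * M" using F(3) M by (intro mult_right_mono) (auto simp: h_def)
      finally show ?thesis using M by simp
    qed
    then have "cmod (l2_inner X (a f) g - l2_inner X f (b g)) \<le> 0" by (rule field_le_epsilon)
    then show "l2_inner X (a f) g = l2_inner X f (b g)" by simp
  qed
  have "b \<in> bops X"
  proof (rule bopsI[where K = K])
    fix f g c assume "f \<in> l2 X" "g \<in> l2 X"
    then show "b (\<lambda>x. c * f x + g x) = (\<lambda>x. c * b f x + b g x)"
      using a by (auto simp: b_def l2_add l2_cmult l2_inner_linear bops_l2)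
  qed (use b_l2 b_norm in \<open>auto simp: b_def\<close>)
  then show ?thesis using adj by blast
qed

lemma adjoint_eqI:
  assumes "b \<in> bops X" "is_adjoint X a b"
  shows "adjoint X a = b"
  unfolding adjoint_def using assms is_adjoint_unique by (intro the_equality) blast+

lemma
  assumes "a \<in> bops X"
  shows adjoint_bops: "adjoint X a \<in> bops X"
    and is_adjoint_adjoint: "is_adjoint X a (adjoint X a)"
proof -
  obtain b where b: "b \<in> bops X" "is_adjoint X a b" using bops_has_adjoint[OF assms] by blast
  then show "adjoint X a \<in> bops X" "is_adjoint X a (adjoint X a)" by (simp_all add: adjoint_eqI)
qed

lemma is_adjoint_sym: "is_adjoint X a b \<Longrightarrow> is_adjoint X b a"
  unfolding is_adjoint_def
proof (intro ballI)
  fix f g assume *: "\<forall>f\<in>l2 X. \<forall>g\<in>l2 X. l2_inner X (a f) g = l2_inner X f (b g)" and "f \<in> l2 X" "g \<in> l2 X"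
  then show "l2_inner X (b f) g = l2_inner X f (a g)"
    unfolding l2_inner_cnj[of X "b f" g] l2_inner_cnj[of X f "a g"] by simp
qed

lemma adjoint_chi: "adjoint X (chi X S) = chi X S"
  by (rule adjoint_eqI[OF chi_bops]) (simp add: is_adjoint_def chi_apply l2_inner_proj)

text \<open>Quasi-locality at one scale \<open>r\<close> and tolerance \<open>e\<close>, stated on
  vectors: no supremum is involved, so sums, products and adjoints become arithmetic in
  \<open>r\<close> and \<open>e\<close>.\<close>

definition ql_bound :: "'a set \<Rightarrow> ('a \<Rightarrow> 'a \<Rightarrow> real) \<Rightarrow> real \<Rightarrow> real \<Rightarrow> 'a op \<Rightarrow> bool" where
  "ql_bound X d r e a \<longleftrightarrow> (\<forall>A B. A \<subseteq> X \<longrightarrow> B \<subseteq> X \<longrightarrow> (\<forall>x\<in>A. \<forall>y\<in>B. r \<le> d x y) \<longrightarrow>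
     (\<forall>f\<in>l2 X. l2_norm X (proj A (a (proj B f))) \<le> e * l2_norm X f))"

lemma ql_boundD:
  assumes "ql_bound X d r e a" "A \<subseteq> X" "B \<subseteq> X" "\<And>x y. x \<in> A \<Longrightarrow> y \<in> B \<Longrightarrow> r \<le> d x y" "f \<in> l2 X"
  shows "l2_norm X (proj A (a (proj B f))) \<le> e * l2_norm X f"
  using assms(1-3,5) assms(4) unfolding ql_bound_def by simp

lemma ql_boundI:
  assumes "\<And>A B f. A \<subseteq> X \<Longrightarrow> B \<subseteq> X \<Longrightarrow> (\<And>x y. x \<in> A \<Longrightarrow> y \<in> B \<Longrightarrow> r \<le> d x y) \<Longrightarrow> f \<in> l2 X \<Longrightarrow>
     l2_norm X (proj A (a (proj B f))) \<le> e * l2_norm X f"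
  shows "ql_bound X d r e a"
  unfolding ql_bound_def by (intro allI impI ballI assms) auto

lemma ql_bound_mono:
  assumes "ql_bound X d r e a" "r \<le> r'" "e \<le> e'"
  shows "ql_bound X d r' e' a"
proof (rule ql_boundI)
  fix A B f assume *: "A \<subseteq> X" "B \<subseteq> X" "\<And>x y. x \<in> A \<Longrightarrow> y \<in> B \<Longrightarrow> r' \<le> d x y" and f: "f \<in> l2 X"
  have "l2_norm X (proj A (a (proj B f))) \<le> e * l2_norm X f"
    using assms(2) by (intro ql_boundD[OF assms(1) *(1,2) _ f]) (meson *(3) order_trans)
  also have "\<dots> \<le> e' * l2_norm X f" using assms(3) by (intro mult_right_mono) auto
  finally show "l2_norm X (proj A (a (proj B f))) \<le> e' * l2_norm X f" .
qed

text \<open>Scaling to the unit ball passes between the supremum and the homogeneous bound;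
  boundedness of \<open>a\<close> is what makes the supremum meaningful.\<close>

lemma quasi_local_iff_ql_bound:
  assumes a: "a \<in> bops X"
  shows "quasi_local X d a \<longleftrightarrow> (\<forall>e>0. \<exists>r>0. ql_bound X d r e a)"
proof -
  obtain K where K: "0 \<le> K" "\<And>f. f \<in> l2 X \<Longrightarrow> l2_norm X (a f) \<le> K * l2_norm X f"
    using bops_bound[OF a] by blast
  define V where "V A B = {l2_norm X ((proj A \<circ> a \<circ> proj B) f) | f. f \<in> l2 X \<and> l2_norm X f \<le> 1}" for A B
  have le: "l2_norm X (proj A (a (proj B f))) \<le> K * l2_norm X f" if f: "f \<in> l2 X" for A B f
  proof -
    have "l2_norm X (proj A (a (proj B f))) \<le> l2_norm X (a (proj B f))"
      using f by (intro l2_norm_proj_le bops_l2[OF a] l2_proj)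
    also have "\<dots> \<le> K * l2_norm X (proj B f)" using f by (intro K(2) l2_proj)
    also have "\<dots> \<le> K * l2_norm X f" using f K(1) by (intro mult_left_mono l2_norm_proj_le)
    finally show ?thesis .
  qed
  have bdd: "bdd_above (V A B)" for A B
  proof (rule bdd_aboveI[of _ K])
    fix v assume "v \<in> V A B"
    then obtain f where f: "f \<in> l2 X" "l2_norm X f \<le> 1" "v = l2_norm X (proj A (a (proj B f)))"
      by (auto simp: V_def)
    have "v \<le> K * l2_norm X f" using le f by simp
    also have "\<dots> \<le> K" using f(2) K(1) mult_left_mono[of "l2_norm X f" 1 K] by simp
    finally show "v \<le> K" .
  qed
  have ne: "V A B \<noteq> {}" for A B
  proof -
    have "l2_norm X ((proj A \<circ> a \<circ> proj B) (\<lambda>_. 0)) \<in> V A B"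
      unfolding V_def by (intro CollectI exI[of _ "\<lambda>_. 0"]) simp
    then show ?thesis by blast
  qed
  have norm: "op_norm X (proj A \<circ> a \<circ> proj B) = Sup (V A B)" for A B
    by (simp add: op_norm_def V_def)
  have below: "l2_norm X (proj A (a (proj B f))) \<le> e * l2_norm X f"
    if e: "op_norm X (proj A \<circ> a \<circ> proj B) < e" and f: "f \<in> l2 X" for A B e f
  proof (cases "l2_norm X f = 0")
    case True
    then show ?thesis using le[OF f, of A B] by simp
  next
    case False
    define n where "n = l2_norm X f"
    have n: "0 < n" using False by (simp add: n_def l2_norm_pos)
    define g where "g = (\<lambda>x. complex_of_real (inverse n) * f x)"
    have g: "g \<in> l2 X" "l2_norm X g \<le> 1"
      using n f by (auto simp: g_def l2_cmult l2_norm_cmult n_def[symmetric] norm_inverse simp del: of_real_inverse)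
    have "proj B g = (\<lambda>x. complex_of_real (inverse n) * proj B f x)"
      by (auto simp: proj_def g_def)
    then have "a (proj B g) = (\<lambda>x. complex_of_real (inverse n) * a (proj B f) x)"
      using a f by (simp add: bops_cmult l2_proj)
    then have "proj A (a (proj B g)) = (\<lambda>x. complex_of_real (inverse n) * proj A (a (proj B f)) x)"
      by (auto simp: proj_def)
    then have "l2_norm X (proj A (a (proj B g))) = inverse n * l2_norm X (proj A (a (proj B f)))"
      using n by (simp add: l2_norm_cmult norm_inverse)
    moreover have "l2_norm X (proj A (a (proj B g))) \<in> V A B"
      unfolding V_def using g by auto
    then have "l2_norm X (proj A (a (proj B g))) \<le> Sup (V A B)"
      using bdd by (rule cSup_upper)
    ultimately have "inverse n * l2_norm X (proj A (a (proj B f))) \<le> e"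
      using e by (simp add: norm)
    then show ?thesis using n by (simp add: n_def[symmetric] field_simps)
  qed
  have above: "op_norm X (proj A \<circ> a \<circ> proj B) \<le> e"
    if e: "0 \<le> e" "\<And>f. f \<in> l2 X \<Longrightarrow> l2_norm X (proj A (a (proj B f))) \<le> e * l2_norm X f" for A B e
    unfolding norm
  proof (rule cSup_least[OF ne])
    fix v assume "v \<in> V A B"
    then obtain f where f: "f \<in> l2 X" "l2_norm X f \<le> 1" "v = l2_norm X (proj A (a (proj B f)))"
      by (auto simp: V_def)
    then show "v \<le> e" using e(2)[OF f(1)] mult_left_mono[OF f(2) e(1)] by simp
  qed
  show ?thesis
  proof
    assume q: "quasi_local X d a"
    show "\<forall>e>0. \<exists>r>0. ql_bound X d r e a"
    proof (intro allI impI)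
      fix e :: real assume "e > 0"
      then obtain r where r: "r > 0" "\<And>A B. A \<subseteq> X \<Longrightarrow> B \<subseteq> X \<Longrightarrow> \<forall>x\<in>A. \<forall>y\<in>B. d x y \<ge> r \<Longrightarrow>
          op_norm X (proj A \<circ> a \<circ> proj B) < e"
        using q unfolding quasi_local_def by blast
      then show "\<exists>r>0. ql_bound X d r e a"
        by (intro exI[of _ r] conjI ql_boundI below r(2)) auto
    qed
  next
    assume q: "\<forall>e>0. \<exists>r>0. ql_bound X d r e a"
    show "quasi_local X d a"
      unfolding quasi_local_def
    proof (intro allI impI)
      fix e :: real assume e: "e > 0"
      \<comment> \<open>Half of \<open>e\<close>, because the supremum inherits only a non-strict
        bound while \<open>quasi_local\<close> asks for a strict one.\<close>
      then obtain r where r: "r > 0" "ql_bound X d r (e / 2) a" using q half_gt_zero by blast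
      have "op_norm X (proj A \<circ> a \<circ> proj B) < e"
        if "A \<subseteq> X" "B \<subseteq> X" "\<forall>x\<in>A. \<forall>y\<in>B. r \<le> d x y" for A B
      proof -
        have "op_norm X (proj A \<circ> a \<circ> proj B) \<le> e / 2"
          using e that by (intro above ql_boundD[OF r(2)]) auto
        then show ?thesis using e by simp
      qed
      then show "\<exists>r>0. \<forall>A B. A \<subseteq> X \<longrightarrow> B \<subseteq> X \<longrightarrow> (\<forall>x\<in>A. \<forall>y\<in>B. r \<le> d x y) \<longrightarrow>
          op_norm X (proj A \<circ> a \<circ> proj B) < e"
        using r(1) by blast
    qed
  qed
qed

lemma Cql_iff: "a \<in> Cql X d \<longleftrightarrow> a \<in> bops X \<and> (\<forall>e>0. \<exists>r>0. ql_bound X d r e a)"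
  by (auto simp: Cql_def quasi_local_iff_ql_bound)

lemma Cql_bops: "a \<in> Cql X d \<Longrightarrow> a \<in> bops X"
  by (simp add: Cql_iff)

lemma Cql_ql_bound: "a \<in> Cql X d \<Longrightarrow> e > 0 \<Longrightarrow> \<exists>r>0. ql_bound X d r e a"
  by (simp add: Cql_iff)

lemma chi_Cql: "chi X S \<in> Cql X d"
  if "Metric_space X d"
  unfolding Cql_iff
proof (intro conjI allI impI)
  fix e :: real assume "e > 0"
  interpret Metric_space X d by fact
  \<comment> \<open>Any positive scale would do: sets at positive distance are disjoint, and
    \<open>chi\<close> does not enlarge supports.\<close>
  have "ql_bound X d 1 e (chi X S)"
  proof (rule ql_boundI)
    fix A B f assume *: "A \<subseteq> X" "B \<subseteq> X" "\<And>x y. x \<in> A \<Longrightarrow> y \<in> B \<Longrightarrow> 1 \<le> d x y" "f \<in> l2 X"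
    have "x \<notin> B" if "x \<in> A" for x
      using *(3)[OF that, of x] *(1) zero[of x x] that by auto
    then have "proj A (chi X S (proj B f)) = (\<lambda>_. 0)"
      unfolding chi_apply[OF l2_proj[OF *(4)]] by (auto simp: proj_def)
    then show "l2_norm X (proj A (chi X S (proj B f))) \<le> e * l2_norm X f"
      using \<open>e > 0\<close> by simp
  qed
  then show "\<exists>r>0. ql_bound X d r e (chi X S)" using zero_less_one by blast
qed (rule chi_bops)

section \<open>Closure of quasi-local operators under the algebra operations\<close>

lemma ql_bound_lincomb:
  assumes a: "a \<in> bops X" "ql_bound X d r e a" and b: "b \<in> bops X" "ql_bound X d r e' b"
  shows "ql_bound X d r (cmod c * e + e') (\<lambda>f x. c * a f x + b f x)"
proof (rule ql_boundI)
  fix A B f assume *: "A \<subseteq> X" "B \<subseteq> X" "\<And>x y. x \<in> A \<Longrightarrow> y \<in> B \<Longrightarrow> r \<le> d x y" "f \<in> l2 X"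
  have "l2_norm X (proj A (\<lambda>x. c * a (proj B f) x + b (proj B f) x))
      \<le> cmod c * l2_norm X (proj A (a (proj B f))) + l2_norm X (proj A (b (proj B f)))"
    unfolding proj_linear using a b *(4)
    by (intro order_trans[OF l2_norm_triangle]) (auto simp: l2_cmult l2_proj bops_l2 l2_norm_cmult)
  also have "\<dots> \<le> cmod c * (e * l2_norm X f) + e' * l2_norm X f"
    using ql_boundD[OF a(2) *] ql_boundD[OF b(2) *] by (intro add_mono mult_left_mono) auto
  finally show "l2_norm X (proj A (\<lambda>x. c * a (proj B f) x + b (proj B f) x))
      \<le> (cmod c * e + e') * l2_norm X f" by (simp add: algebra_simps)
qed

lemma Cql_lincomb:
  assumes a: "a \<in> Cql X d" and b: "b \<in> Cql X d"
  shows "(\<lambda>f x. c * a f x + b f x) \<in> Cql X d"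
  unfolding Cql_iff
proof (intro conjI allI impI)
  show "(\<lambda>f x. c * a f x + b f x) \<in> bops X" using a b by (intro bops_lincomb Cql_bops)
  fix e :: real assume e: "e > 0"
  define e' where "e' = e / (cmod c + 1)"
  have c: "0 < cmod c + 1" by (simp add: add_nonneg_pos)
  then have e': "0 < e'" using e by (simp add: e'_def)
  obtain r where r: "r > 0" "ql_bound X d r e' a" using Cql_ql_bound[OF a e'] by blast
  obtain s where s: "s > 0" "ql_bound X d s e' b" using Cql_ql_bound[OF b e'] by blast
  have "ql_bound X d (max r s) (cmod c * e' + e') (\<lambda>f x. c * a f x + b f x)"
    using a b r s by (intro ql_bound_lincomb Cql_bops) (auto intro: ql_bound_mono)
  moreover have "cmod c * e' + e' = (cmod c + 1) * e'" by (simp add: algebra_simps)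
  moreover have "\<dots> = e" using c by (simp add: e'_def)
  ultimately show "\<exists>r>0. ql_bound X d r e (\<lambda>f x. c * a f x + b f x)"
    using r(1) by (intro exI[of _ "max r s"]) simp
qed

text \<open>The \<open>r\<close>-neighbourhood \<open>C\<close> of \<open>A\<close> splits the
  intermediate vector: off \<open>C\<close> the operator \<open>a\<close> is small towards
  \<open>A\<close>, and \<open>C\<close> is still \<open>r\<close> away from \<open>B\<close>, so
  \<open>b\<close> is small there. This costs a factor 2 in the scale.\<close>

lemma ql_bound_comp:
  assumes "Metric_space X d"
    and a: "a \<in> bops X" "ql_bound X d r e a" "\<And>f. f \<in> l2 X \<Longrightarrow> l2_norm X (a f) \<le> K * l2_norm X f" "0 \<le> K"
    and b: "b \<in> bops X" "ql_bound X d r e' b" "\<And>f. f \<in> l2 X \<Longrightarrow> l2_norm X (b f) \<le> L * l2_norm X f"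
    and "0 \<le> e"
  shows "ql_bound X d (2 * r) (e * L + K * e') (a \<circ> b)"
proof (rule ql_boundI)
  interpret Metric_space X d by fact
  fix A B f assume *: "A \<subseteq> X" "B \<subseteq> X" "\<And>x y. x \<in> A \<Longrightarrow> y \<in> B \<Longrightarrow> 2 * r \<le> d x y" and f: "f \<in> l2 X"
  define C where "C = {z \<in> X. \<exists>x\<in>A. d x z < r}"
  define g where "g = b (proj B f)"
  have g: "g \<in> l2 X" using b(1) f by (auto simp: g_def bops_l2 l2_proj)
  have split: "g = (\<lambda>x. proj (X - C) g x + proj C g x)"
    using l2_outside[OF g] by (auto simp: proj_def fun_eq_iff C_def)
  have "a g = (\<lambda>x. a (proj (X - C) g) x + a (proj C g) x)"
    using a(1) g by (subst split) (simp add: bops_add l2_proj)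
  then have "proj A (a g) = (\<lambda>x. proj A (a (proj (X - C) g)) x + proj A (a (proj C g)) x)"
    by (auto simp: proj_def)
  then have "l2_norm X (proj A (a g)) \<le>
      l2_norm X (proj A (a (proj (X - C) g))) + l2_norm X (proj A (a (proj C g)))"
    using a(1) g by (simp add: l2_norm_triangle l2_proj bops_l2)
  moreover have "l2_norm X (proj A (a (proj (X - C) g))) \<le> e * L * l2_norm X f"
  proof -
    have "l2_norm X (proj A (a (proj (X - C) g))) \<le> e * l2_norm X g"
      using *(1) by (intro ql_boundD[OF a(2)] g) (auto simp: C_def not_less)
    also have "l2_norm X g \<le> L * l2_norm X (proj B f)" unfolding g_def using f by (intro b(3) l2_proj)
    \<comment> \<open>Multiplying by \<open>L\<close> needs its sign: the bound on \<open>b\<close>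
      forces \<open>0 \<le> L\<close> once \<open>f\<close> has positive norm, and otherwise both
      sides vanish.\<close>
    also have "L * l2_norm X (proj B f) \<le> L * l2_norm X f"
    proof (cases "l2_norm X f = 0")
      case True
      then have "l2_norm X (proj B f) = 0" using l2_norm_proj_le[OF f, of B] l2_norm_nonneg[of X "proj B f"] by linarith
      then show ?thesis using True by simp
    next
      case False
      then have "0 < l2_norm X f" by (rule l2_norm_pos)
      moreover have "0 \<le> L * l2_norm X f" using b(3)[OF f] l2_norm_nonneg order_trans by blast
      ultimately have "0 \<le> L" by (simp add: zero_le_mult_iff)
      then show ?thesis using l2_norm_proj_le[OF f] by (intro mult_left_mono)
    qed
    finally show ?thesis using \<open>0 \<le> e\<close> by (simp add: mult.assoc mult_left_mono)
  qed
  moreover have "l2_norm X (proj A (a (proj C g))) \<le> K * e' * l2_norm X f"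
  proof -
    have sep: "r \<le> d z y" if "z \<in> C" "y \<in> B" for z y
    proof -
      obtain x where x: "x \<in> A" "d x z < r" using \<open>z \<in> C\<close> by (auto simp: C_def)
      have "2 * r \<le> d x y" using * x that by blast
      also have "d x y \<le> d x z + d z y" using x *(1,2) that by (intro triangle) (auto simp: C_def)
      finally show ?thesis using x(2) by linarith
    qed
    have "l2_norm X (proj A (a (proj C g))) \<le> l2_norm X (a (proj C g))"
      using g by (intro l2_norm_proj_le bops_l2[OF a(1)] l2_proj)
    also have "\<dots> \<le> K * l2_norm X (proj C g)" using g by (intro a(3) l2_proj)
    also have "l2_norm X (proj C g) \<le> e' * l2_norm X f"
      unfolding g_def using *(2) sep by (intro ql_boundD[OF b(2)] f) (auto simp: C_def)
    finally show ?thesis using a(4) by (simp add: mult.assoc mult_left_mono)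
  qed
  ultimately show "l2_norm X (proj A ((a \<circ> b) (proj B f))) \<le> (e * L + K * e') * l2_norm X f"
    by (simp add: g_def algebra_simps)
qed

lemma Cql_comp:
  assumes m: "Metric_space X d" and a: "a \<in> Cql X d" and b: "b \<in> Cql X d"
  shows "a \<circ> b \<in> Cql X d"
  unfolding Cql_iff
proof (intro conjI allI impI)
  show "a \<circ> b \<in> bops X" using a b by (intro bops_comp Cql_bops)
  obtain K where K: "0 \<le> K" "\<And>f. f \<in> l2 X \<Longrightarrow> l2_norm X (a f) \<le> K * l2_norm X f"
    using bops_bound[OF Cql_bops[OF a]] by blast
  obtain L where L: "0 \<le> L" "\<And>f. f \<in> l2 X \<Longrightarrow> l2_norm X (b f) \<le> L * l2_norm X f"
    using bops_bound[OF Cql_bops[OF b]] by blast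
  fix e :: real assume e: "e > 0"
  define e' where "e' = e / (K + L + 1)"
  have e': "0 < e'" using e K(1) L(1) by (simp add: e'_def)
  obtain r where r: "r > 0" "ql_bound X d r e' a" using Cql_ql_bound[OF a e'] by blast
  obtain s where s: "s > 0" "ql_bound X d s e' b" using Cql_ql_bound[OF b e'] by blast
  have "ql_bound X d (2 * max r s) (e' * L + K * e') (a \<circ> b)"
    using e' by (intro ql_bound_comp[OF m Cql_bops[OF a] _ K(2,1) Cql_bops[OF b] _ L(2)])
      (auto intro: ql_bound_mono[OF r(2)] ql_bound_mono[OF s(2)])
  moreover have "e' * L + K * e' \<le> (K + L + 1) * e'" using e' by (simp add: algebra_simps)
  moreover have "\<dots> = e" using K(1) L(1) by (simp add: e'_def)
  ultimately have "ql_bound X d (2 * max r s) e (a \<circ> b)" by (auto intro: ql_bound_mono)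
  then show "\<exists>r>0. ql_bound X d r e (a \<circ> b)" using r(1) by (intro exI[of _ "2 * max r s"]) simp
qed

text \<open>\<open>proj A\<close> and \<open>proj B\<close> change places when moved across the
  inner product; the same scale works because the metric is symmetric.\<close>

lemma Cql_adjoint:
  assumes m: "Metric_space X d" and a: "a \<in> Cql X d"
  shows "adjoint X a \<in> Cql X d"
  unfolding Cql_iff
proof (intro conjI allI impI)
  interpret Metric_space X d by fact
  have aB: "a \<in> bops X" using a by (rule Cql_bops)
  show bB: "adjoint X a \<in> bops X" using aB by (rule adjoint_bops)
  fix e :: real assume e: "e > 0"
  obtain r where r: "r > 0" "ql_bound X d r e a" using Cql_ql_bound[OF a e] by blast
  have "ql_bound X d r e (adjoint X a)"
  proof (rule ql_boundI)
    fix A B f assume *: "A \<subseteq> X" "B \<subseteq> X" "\<And>x y. x \<in> A \<Longrightarrow> y \<in> B \<Longrightarrow> r \<le> d x y" and f: "f \<in> l2 X"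
    have sep: "r \<le> d y x" if "x \<in> A" "y \<in> B" for x y
      using *(3)[OF that] by (simp add: commute)
    show "l2_norm X (proj A (adjoint X a (proj B f))) \<le> e * l2_norm X f"
    proof (rule l2_norm_le_inner_bound)
      show "proj A (adjoint X a (proj B f)) \<in> l2 X" using f by (intro l2_proj bops_l2[OF bB])
      show "0 \<le> e * l2_norm X f" using e by simp
      fix g assume g: "g \<in> l2 X"
      have "l2_inner X (proj A (adjoint X a (proj B f))) g = l2_inner X f (proj B (a (proj A g)))"
        using is_adjoint_sym[OF is_adjoint_adjoint[OF aB]] f g
        by (simp add: l2_inner_proj is_adjoint_def l2_proj)
      then have "cmod (l2_inner X (proj A (adjoint X a (proj B f))) g)
          \<le> l2_norm X f * l2_norm X (proj B (a (proj A g)))"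
        using f g aB by (simp add: l2_Cauchy_Schwarz l2_proj bops_l2)
      also have "\<dots> \<le> l2_norm X f * (e * l2_norm X g)"
        using *(1,2) sep by (intro mult_left_mono ql_boundD[OF r(2)] g) auto
      finally show "cmod (l2_inner X (proj A (adjoint X a (proj B f))) g) \<le> e * l2_norm X f * l2_norm X g"
        by (simp add: mult_ac)
    qed
  qed
  then show "\<exists>r>0. ql_bound X d r e (adjoint X a)" using r(1) by blast
qed

text \<open>Each identity for the inverse is obtained by applying \<phi> and then cancelling it; the
  cancellation needs the combined operator to lie in the algebra, which the closure lemmas
  provide.\<close>

lemma star_isomorphism_sym:
  assumes mX: "Metric_space X dX" and mY: "Metric_space Y dY"
    and \<phi>: "star_isomorphism X dX Y dY \<phi>"
  shows "star_isomorphism Y dY X dX (inv_into (Cql X dX) \<phi>)"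
proof -
  define \<psi> where "\<psi> = inv_into (Cql X dX) \<phi>"
  have bij: "bij_betw \<phi> (Cql X dX) (Cql Y dY)"
    and lin: "\<And>a b c. a \<in> Cql X dX \<Longrightarrow> b \<in> Cql X dX \<Longrightarrow>
        \<phi> (\<lambda>f x. c * a f x + b f x) = (\<lambda>g y. c * \<phi> a g y + \<phi> b g y)"
    and mult: "\<And>a b. a \<in> Cql X dX \<Longrightarrow> b \<in> Cql X dX \<Longrightarrow> \<phi> (a \<circ> b) = \<phi> a \<circ> \<phi> b"
    and adj: "\<And>a. a \<in> Cql X dX \<Longrightarrow> \<phi> (adjoint X a) = adjoint Y (\<phi> a)"
    using \<phi> unfolding star_isomorphism_def by blast+
  have bij': "bij_betw \<psi> (Cql Y dY) (Cql X dX)"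
    unfolding \<psi>_def using bij by (rule bij_betw_inv_into)
  have in_X: "\<psi> b \<in> Cql X dX" if "b \<in> Cql Y dY" for b
    using bij' that by (auto simp: bij_betw_def)
  have right: "\<phi> (\<psi> b) = b" if "b \<in> Cql Y dY" for b
    unfolding \<psi>_def using bij that by (rule bij_betw_inv_into_right)
  have left: "\<psi> (\<phi> a) = a" if "a \<in> Cql X dX" for a
    unfolding \<psi>_def using bij that by (rule bij_betw_inv_into_left)
  show ?thesis
    unfolding star_isomorphism_def \<psi>_def[symmetric]
  proof (intro conjI ballI allI)
    fix a b and c :: complex assume ab: "a \<in> Cql Y dY" "b \<in> Cql Y dY"
    have "\<phi> (\<lambda>f x. c * \<psi> a f x + \<psi> b f x) = (\<lambda>f x. c * a f x + b f x)"
      using lin[OF in_X[OF ab(1)] in_X[OF ab(2)]] ab by (simp add: right)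
    then show "\<psi> (\<lambda>f x. c * a f x + b f x) = (\<lambda>g y. c * \<psi> a g y + \<psi> b g y)"
      using left[OF Cql_lincomb[OF in_X[OF ab(1)] in_X[OF ab(2)]], of c] by simp
    have "\<phi> (\<psi> a \<circ> \<psi> b) = a \<circ> b" using mult[OF in_X[OF ab(1)] in_X[OF ab(2)]] ab by (simp add: right)
    then show "\<psi> (a \<circ> b) = \<psi> a \<circ> \<psi> b"
      using left[OF Cql_comp[OF mX in_X[OF ab(1)] in_X[OF ab(2)]]] by simp
  next
    fix a assume a: "a \<in> Cql Y dY"
    have "\<phi> (adjoint X (\<psi> a)) = adjoint Y a" using adj[OF in_X[OF a]] a by (simp add: right)
    then show "\<psi> (adjoint Y a) = adjoint X (\<psi> a)"
      using left[OF Cql_adjoint[OF mX in_X[OF a]]] by simp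
  qed (rule bij')
qed

text \<open>Its matrix has entry 1 exactly at the pairs at distance at most \<open>r\<close>. One
  element of the algebra thus links all close pairs, so the quasi-local scale of its image serves
  all of them at once.\<close>

definition band_op :: "'a set \<Rightarrow> ('a \<Rightarrow> 'a \<Rightarrow> real) \<Rightarrow> real \<Rightarrow> 'a op" where
  "band_op X d r f = (\<lambda>x. if f \<in> l2 X \<and> x \<in> X then \<Sum>z\<in>{z \<in> X. d x z \<le> r}. f z else 0)"

text \<open>Schur's test: Cauchy-Schwarz on each ball, and the fact that a point lies in at most
  \<open>N\<close> balls, bound the norm by \<open>N\<close>.\<close>

lemma band_op_Cql:
  assumes m: "Metric_space X d" and u: "ulf X d" and r: "r > 0"
  shows "band_op X d r \<in> Cql X d"
proof -
  interpret Metric_space X d by fact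
  define B where "B x = {z \<in> X. d x z \<le> r}" for x
  obtain N :: nat where N: "\<And>x. x \<in> X \<Longrightarrow> finite (B x)" "\<And>x. x \<in> X \<Longrightarrow> card (B x) \<le> N"
    using u[unfolded ulf_def, rule_format, OF r] unfolding B_def by metis
  have apply_in: "band_op X d r f x = (\<Sum>z\<in>B x. f z)" if "f \<in> l2 X" "x \<in> X" for f x
    using that by (simp add: band_op_def B_def)
  have fin: "L2_set (\<lambda>x. cmod (band_op X d r f x)) F \<le> real N * l2_norm X f"
    if f: "f \<in> l2 X" and F: "finite F" "F \<subseteq> X" for f F
  proof -
    define G where "G = (\<Union>x\<in>F. B x)"
    have G: "finite G" "G \<subseteq> X" using N(1) F by (auto simp: G_def B_def)
    have "(cmod (band_op X d r f x))\<^sup>2 \<le> N * (\<Sum>z\<in>B x. (cmod (f z))\<^sup>2)" if x: "x \<in> F" for x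
    proof -
      have "cmod (band_op X d r f x) \<le> (\<Sum>z\<in>B x. cmod (f z))"
        using apply_in[OF f, of x] x F(2) norm_sum[of f "B x"] by auto
      also have "\<dots> \<le> L2_set (\<lambda>_. 1) (B x) * L2_set (\<lambda>z. cmod (f z)) (B x)"
        using L2_set_mult_ineq[of "\<lambda>_. 1" "\<lambda>z. cmod (f z)" "B x"] by simp
      finally have "(cmod (band_op X d r f x))\<^sup>2 \<le> (L2_set (\<lambda>_. 1) (B x) * L2_set (\<lambda>z. cmod (f z)) (B x))\<^sup>2"
        by (intro power_mono) auto
      also have "\<dots> = card (B x) * (\<Sum>z\<in>B x. (cmod (f z))\<^sup>2)"
        by (simp add: power_mult_distrib L2_set_def sum_nonneg)
      also have "\<dots> \<le> N * (\<Sum>z\<in>B x. (cmod (f z))\<^sup>2)"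
        using N(2)[of x] x F(2) by (intro mult_right_mono sum_nonneg) auto
      finally show ?thesis .
    qed
    then have "(\<Sum>x\<in>F. (cmod (band_op X d r f x))\<^sup>2) \<le> N * (\<Sum>x\<in>F. \<Sum>z\<in>B x. (cmod (f z))\<^sup>2)"
      by (simp add: sum_distrib_left sum_mono)
    also have "(\<Sum>x\<in>F. \<Sum>z\<in>B x. (cmod (f z))\<^sup>2) = (\<Sum>x\<in>F. \<Sum>z\<in>{z\<in>G. d x z \<le> r}. (cmod (f z))\<^sup>2)"
      using G(2) by (intro sum.cong refl) (auto simp: G_def B_def)
    also have "\<dots> = (\<Sum>z\<in>G. \<Sum>x\<in>{x\<in>F. d x z \<le> r}. (cmod (f z))\<^sup>2)"
      using F(1) G(1) by (rule sum.swap_restrict)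
    also have "\<dots> \<le> (\<Sum>z\<in>G. N * (cmod (f z))\<^sup>2)"
    proof (intro sum_mono)
      fix z assume z: "z \<in> G"
      have "card {x\<in>F. d x z \<le> r} \<le> card (B z)"
        using z G F(2) by (intro card_mono N(1)) (auto simp: B_def commute[of z])
      also have "\<dots> \<le> N" using N(2) z G by auto
      finally show "(\<Sum>x\<in>{x\<in>F. d x z \<le> r}. (cmod (f z))\<^sup>2) \<le> N * (cmod (f z))\<^sup>2"
        by (simp add: mult_right_mono)
    qed
    also have "\<dots> \<le> N * (l2_norm X f)\<^sup>2"
      using sum_le_l2_norm[OF f G] by (simp add: sum_distrib_left[symmetric] mult_left_mono)
    finally have "(\<Sum>x\<in>F. (cmod (band_op X d r f x))\<^sup>2) \<le> (N * l2_norm X f)\<^sup>2"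
      by (simp add: power_mult_distrib power2_eq_square[of "real N"] mult.assoc mult_left_mono)
    then show ?thesis unfolding L2_set_def by (intro real_le_lsqrt) (auto simp: sum_nonneg)
  qed
  have bnd: "band_op X d r f \<in> l2 X" "l2_norm X (band_op X d r f) \<le> N * l2_norm X f" if "f \<in> l2 X" for f
    using l2_bounded_finite_sumsI[of X "band_op X d r f" "N * l2_norm X f"] fin that
    by (auto simp: band_op_def)
  have bops: "band_op X d r \<in> bops X"
    by (rule bopsI[where K = N])
      (use bnd in \<open>auto simp: band_op_def l2_add l2_cmult sum.distrib sum_distrib_left\<close>)
  \<comment> \<open>\<open>2 * r\<close> instead of \<open>r\<close>: entries at distance exactly
    \<open>r\<close> equal 1, so the sets must be strictly further apart.\<close>
  have "ql_bound X d (2 * r) e (band_op X d r)" if e: "e > 0" for e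
  proof (rule ql_boundI)
    fix A C f assume *: "A \<subseteq> X" "C \<subseteq> X" "\<And>x y. x \<in> A \<Longrightarrow> y \<in> C \<Longrightarrow> 2 * r \<le> d x y" and f: "f \<in> l2 X"
    have "(\<Sum>z\<in>B x. proj C f z) = 0" if "x \<in> A" for x
    proof (rule sum.neutral, rule ballI)
      fix z assume "z \<in> B x"
      then have "z \<notin> C" using *(3)[OF that, of z] r by (auto simp: B_def)
      then show "proj C f z = 0" by (simp add: proj_def)
    qed
    then have "proj A (band_op X d r (proj C f)) = (\<lambda>_. 0)"
      using *(1) apply_in[OF l2_proj[OF f], of _ C] by (auto simp: proj_def[of A] fun_eq_iff)
    then show "l2_norm X (proj A (band_op X d r (proj C f))) \<le> e * l2_norm X f" using e by simp
  qed
  then show ?thesis unfolding Cql_iff using bops r by (auto intro!: exI[of _ "2 * r"])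
qed

section \<open>Images of coordinate projections under an isomorphism\<close>

lemma cmod_entry_le:
  assumes "a \<in> bops X" "ql_bound X d r e a" "x \<in> X" "y \<in> X" "r \<le> d x y"
  shows "cmod (a (ket y) x) \<le> e"
proof -
  have "proj {y} (ket y) = ket y" by (auto simp: proj_def ket_def)
  then have "l2_norm X (proj {x} (a (ket y))) \<le> e * l2_norm X (ket y)"
    using ql_boundD[OF assms(2), of "{x}" "{y}" "ket y"] assms by auto
  moreover have "cmod (proj {x} (a (ket y)) x) \<le> l2_norm X (proj {x} (a (ket y)))"
    using assms by (intro cmod_le_l2_norm l2_proj bops_l2[OF assms(1)]) simp
  ultimately show ?thesis using assms by (simp add: proj_def)
qed

text \<open>Compression to a one-dimensional range is a scalar. The zero operator
  \<open>chi X {}\<close> is added so that the right-hand side has the form to which linearity of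
  the isomorphism applies.\<close>

lemma chi_sandwich:
  assumes a: "a \<in> bops X" and x: "x \<in> X"
  shows "chi X {x} \<circ> (a \<circ> chi X {x}) = (\<lambda>f z. a (ket x) x * chi X {x} f z + chi X {} f z)"
proof
  fix f
  show "(chi X {x} \<circ> (a \<circ> chi X {x})) f = (\<lambda>z. a (ket x) x * chi X {x} f z + chi X {} f z)"
  proof (cases "f \<in> l2 X")
    case True
    then have "a (chi X {x} f) = (\<lambda>z. f x * a (ket x) z)"
      using x by (simp add: chi_apply proj_singleton bops_cmult[OF a])
    moreover have "a (chi X {x} f) \<in> l2 X" using True by (simp add: chi_apply l2_proj bops_l2[OF a])
    ultimately show ?thesis
      using True by (auto simp: chi_apply proj_def)
  next
    case False
    then have "a (chi X {x} f) = (\<lambda>_. 0)" using bops_zero[OF a] by (simp add: chi_def)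
    then show ?thesis using False by (simp add: chi_def proj_def)
  qed
qed

locale ql_iso =
  fixes X :: "'a set" and dX :: "'a \<Rightarrow> 'a \<Rightarrow> real" and Y :: "'b set" and dY :: "'b \<Rightarrow> 'b \<Rightarrow> real"
    and \<phi> :: "'a op \<Rightarrow> 'b op"
  assumes mX: "Metric_space X dX" and mY: "Metric_space Y dY"
    and ulfX: "ulf X dX" and ulfY: "ulf Y dY"
    and iso: "star_isomorphism X dX Y dY \<phi>"
begin

abbreviation \<psi> :: "'b op \<Rightarrow> 'a op" where
  "\<psi> \<equiv> inv_into (Cql X dX) \<phi>"

lemma bij: "bij_betw \<phi> (Cql X dX) (Cql Y dY)"
  and lin: "\<And>a b c. a \<in> Cql X dX \<Longrightarrow> b \<in> Cql X dX \<Longrightarrow>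
        \<phi> (\<lambda>f x. c * a f x + b f x) = (\<lambda>g y. c * \<phi> a g y + \<phi> b g y)"
  and mult: "\<And>a b. a \<in> Cql X dX \<Longrightarrow> b \<in> Cql X dX \<Longrightarrow> \<phi> (a \<circ> b) = \<phi> a \<circ> \<phi> b"
  and adj: "\<And>a. a \<in> Cql X dX \<Longrightarrow> \<phi> (adjoint X a) = adjoint Y (\<phi> a)"
  using iso unfolding star_isomorphism_def by blast+

lemma \<phi>_Cql: "a \<in> Cql X dX \<Longrightarrow> \<phi> a \<in> Cql Y dY"
  using bij by (auto simp: bij_betw_def)

lemma \<psi>_Cql: "b \<in> Cql Y dY \<Longrightarrow> \<psi> b \<in> Cql X dX"
  using bij_betw_inv_into[OF bij] by (auto simp: bij_betw_def)

lemma \<phi>_\<psi>: "b \<in> Cql Y dY \<Longrightarrow> \<phi> (\<psi> b) = b"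
  by (rule bij_betw_inv_into_right[OF bij])

lemma \<psi>_\<phi>: "a \<in> Cql X dX \<Longrightarrow> \<psi> (\<phi> a) = a"
  by (rule bij_betw_inv_into_left[OF bij])

lemma chi_X: "chi X S \<in> Cql X dX" and chi_Y: "chi Y T \<in> Cql Y dY"
  using chi_Cql[OF mX] chi_Cql[OF mY] by blast+

definition P :: "'a set \<Rightarrow> 'b op" where
  "P S = \<phi> (chi X S)"

lemma P_Cql: "P S \<in> Cql Y dY"
  by (simp add: P_def \<phi>_Cql chi_X)

lemma P_bops: "P S \<in> bops Y"
  using P_Cql by (rule Cql_bops)

lemma P_l2 [simp]: "f \<in> l2 Y \<Longrightarrow> P S f \<in> l2 Y"
  using P_bops by (rule bops_l2)

lemma P_union:
  assumes "S \<inter> T = {}"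
  shows "P (S \<union> T) f y = P S f y + P T f y"
proof -
  have "chi X (S \<union> T) = (\<lambda>f x. 1 * chi X S f x + chi X T f x)"
    using assms by (auto simp: chi_def proj_def fun_eq_iff)
  then have "P (S \<union> T) = (\<lambda>f x. 1 * P S f x + P T f x)"
    unfolding P_def using lin[OF chi_X chi_X, of 1 S T] by simp
  then show ?thesis by simp
qed

lemma P_empty: "P {} f y = 0"
  using P_union[of "{}" "{}" f y] by simp

lemma P_P: "P S (P T f) = P (S \<inter> T) f"
proof -
  have "chi X S \<circ> chi X T = chi X (S \<inter> T)"
    by (auto simp: chi_def proj_def fun_eq_iff l2_proj[unfolded proj_def])
  then have "P S \<circ> P T = P (S \<inter> T)"
    unfolding P_def using mult[OF chi_X chi_X] by metis
  then show ?thesis by (metis comp_apply)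
qed

text \<open>Unitality is derived: the identity on \<open>l2 Y\<close> is the image of some
  \<open>a\<close>, and \<open>chi X X\<close> acts on \<open>a\<close> as a left unit.\<close>

lemma P_X:
  assumes "f \<in> l2 Y"
  shows "P X f = f"
proof -
  define a where "a = \<psi> (chi Y Y)"
  have a: "a \<in> Cql X dX" "\<phi> a = chi Y Y" by (simp_all add: a_def \<psi>_Cql \<phi>_\<psi> chi_Y)
  have "chi X X \<circ> a = a"
    by (rule bops_eqI)
      (use Cql_bops[OF a(1)] in \<open>auto simp: bops_comp chi_bops chi_apply bops_l2 proj_l2_self\<close>)
  then have "P X \<circ> chi Y Y = chi Y Y"
    unfolding P_def using mult[OF chi_X a(1)] a(2) by metis
  then have "P X (chi Y Y f) = chi Y Y f" by (metis comp_apply)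
  then show ?thesis using assms by (simp add: chi_apply proj_l2_self)
qed

lemma P_finite:
  assumes "finite F"
  shows "P F f y = (\<Sum>x\<in>F. P {x} f y)"
  using assms
proof (induction F)
  case (insert x F)
  then show ?case using P_union[of "{x}" F f y] by simp
qed (simp add: P_empty)

lemma P_self_adjoint:
  assumes "f \<in> l2 Y" "g \<in> l2 Y"
  shows "l2_inner Y (P S f) g = l2_inner Y f (P S g)"
proof -
  have "adjoint Y (P S) = P S"
    unfolding P_def using adj[OF chi_X, of S] by (simp add: adjoint_chi)
  then have "is_adjoint Y (P S) (P S)" using is_adjoint_adjoint[OF P_bops, of S] by simp
  then show ?thesis using assms by (simp add: is_adjoint_def)
qed

text \<open>For a self-adjoint idempotent the squared norm of \<open>P S f\<close> is its inner
  product with \<open>f\<close>, so contractivity comes from the algebraic relations alone.\<close>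

lemma l2_norm_P_le:
  assumes f: "f \<in> l2 Y"
  shows "l2_norm Y (P S f) \<le> l2_norm Y f"
proof (cases "l2_norm Y (P S f) = 0")
  case False
  have "l2_inner Y (P S f) (P S f) = l2_inner Y (P S f) f"
    using P_self_adjoint[of "P S f" f S] f by (simp add: P_P)
  then have "(l2_norm Y (P S f))\<^sup>2 = cmod (l2_inner Y (P S f) f)"
    using f by (metis P_l2 abs_of_nonneg l2_inner_self norm_of_real zero_le_power2)
  then have "(l2_norm Y (P S f))\<^sup>2 \<le> l2_norm Y (P S f) * l2_norm Y f"
    using l2_Cauchy_Schwarz[of "P S f" Y f] f by simp
  then show ?thesis using l2_norm_pos[OF False] by (simp add: power2_eq_square)
qed simp

text \<open>For fixed \<open>y\<close> in \<open>Y\<close> this is a finitely additive probability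
  measure on the subsets of \<open>X\<close>. The squared norm makes positivity evident;
  \<open>P_diag\<close> identifies it with the diagonal entry of \<open>P S\<close>.\<close>

definition m :: "'a set \<Rightarrow> 'b \<Rightarrow> real" where
  "m S y = (l2_norm Y (P S (ket y)))\<^sup>2"

lemma m_nonneg: "0 \<le> m S y"
  by (simp add: m_def)

lemma P_entry_inner:
  assumes "y \<in> Y" "z \<in> Y"
  shows "P S (ket y) z = l2_inner Y (P S (ket y)) (P S (ket z))"
proof -
  have "P S (ket y) z = l2_inner Y (P S (P S (ket y))) (ket z)"
    using assms by (simp add: P_P l2_inner_ket)
  then show ?thesis using assms P_self_adjoint[of "P S (ket y)" "ket z" S] by simp
qed

lemma P_diag: "y \<in> Y \<Longrightarrow> P S (ket y) y = complex_of_real (m S y)"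
  by (simp add: P_entry_inner l2_inner_self m_def)

lemma P_entry_le:
  assumes "y \<in> Y" "z \<in> Y"
  shows "(cmod (P S (ket y) z))\<^sup>2 \<le> m S y * m S z"
proof -
  have "cmod (P S (ket y) z) \<le> l2_norm Y (P S (ket y)) * l2_norm Y (P S (ket z))"
    unfolding P_entry_inner[OF assms] using assms by (intro l2_Cauchy_Schwarz) auto
  then have "(cmod (P S (ket y) z))\<^sup>2 \<le> (l2_norm Y (P S (ket y)) * l2_norm Y (P S (ket z)))\<^sup>2"
    by (intro power_mono) auto
  then show ?thesis by (simp add: m_def power_mult_distrib)
qed

text \<open>\<open>P S\<close> can be moved onto \<open>ket y\<close>. Sets of small mass at
  \<open>y\<close> therefore barely affect the coordinate at \<open>y\<close> of any vector.\<close>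

lemma P_coordinate_le:
  assumes "f \<in> l2 Y" "y \<in> Y"
  shows "cmod (P S f y) \<le> l2_norm Y f * sqrt (m S y)"
proof -
  have "P S f y = l2_inner Y f (P S (ket y))"
    using assms P_self_adjoint[of f "ket y" S] by (simp add: l2_inner_ket)
  then show ?thesis using l2_Cauchy_Schwarz[of f Y "P S (ket y)"] assms by (simp add: m_def)
qed

lemma m_union: "S \<inter> T = {} \<Longrightarrow> y \<in> Y \<Longrightarrow> m (S \<union> T) y = m S y + m T y"
  using P_union[of S T "ket y" y] by (simp add: P_diag flip: of_real_add)

lemma m_X: "y \<in> Y \<Longrightarrow> m X y = 1"
  by (simp add: m_def P_X)

lemma m_mono: "S \<subseteq> T \<Longrightarrow> y \<in> Y \<Longrightarrow> m S y \<le> m T y"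
  using m_union[of S "T - S" y] m_nonneg[of "T - S" y] by (simp add: Un_absorb1)

lemma m_finite: "finite F \<Longrightarrow> y \<in> Y \<Longrightarrow> m F y = (\<Sum>x\<in>F. m {x} y)"
  using P_finite[of F "ket y" y] by (simp add: P_diag flip: of_real_sum)

lemma m_le_1: "S \<subseteq> X \<Longrightarrow> y \<in> Y \<Longrightarrow> m S y \<le> 1"
  using m_mono[of S X y] m_X by simp

text \<open>The assumptions are symmetric, so results for \<phi> can be read for \<psi> with
  \<open>X\<close> and \<open>Y\<close> exchanged; this supplies the second direction
  throughout.\<close>

lemma ql_iso_inverse: "ql_iso Y dY X dX \<psi>"
  by (intro ql_iso.intro mX mY ulfX ulfY star_isomorphism_sym iso)

end

section \<open>Symmetry and countable additivity of the entries\<close>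

context ql_iso
begin

interpretation inv: ql_iso Y dY X dX \<psi>
  by (rule ql_iso_inverse)

lemma \<phi>_inv_P: "\<phi> (inv.P T) = chi Y T"
  by (simp add: inv.P_def \<phi>_\<psi> chi_Y)

lemma m_symmetric:
  assumes x: "x \<in> X" and y: "y \<in> Y"
  shows "inv.m {y} x = m {x} y"
proof -
  have "\<psi> (chi Y {y} \<circ> (P {x} \<circ> chi Y {y})) = inv.P {y} \<circ> (chi X {x} \<circ> inv.P {y})"
    using inv.mult[OF chi_Y Cql_comp[OF mY P_Cql chi_Y]] inv.mult[OF P_Cql chi_Y]
    by (simp add: inv.P_def P_def \<psi>_\<phi> chi_X)
  then have "inv.P {y} \<circ> (chi X {x} \<circ> inv.P {y})
      = (\<lambda>f z. complex_of_real (m {x} y) * inv.P {y} f z + inv.P {} f z)"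
    unfolding chi_sandwich[OF P_bops y] P_diag[OF y] inv.lin[OF chi_Y chi_Y] inv.P_def by simp
  from fun_cong[OF fun_cong[OF this], of "ket x" x]
  have 1: "inv.m {y} x * inv.m {y} x = m {x} y * inv.m {y} x"
    using x by (simp add: inv.P_empty chi_apply proj_singleton bops_cmult[OF inv.P_bops] inv.P_diag
        flip: of_real_mult)
  have "\<phi> (chi X {x} \<circ> (inv.P {y} \<circ> chi X {x})) = P {x} \<circ> (chi Y {y} \<circ> P {x})"
    using mult[OF chi_X Cql_comp[OF mX inv.P_Cql chi_X]] mult[OF inv.P_Cql chi_X]
    by (simp add: \<phi>_inv_P P_def)
  then have "P {x} \<circ> (chi Y {y} \<circ> P {x})
      = (\<lambda>f z. complex_of_real (inv.m {y} x) * P {x} f z + P {} f z)"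
    unfolding chi_sandwich[OF inv.P_bops x] inv.P_diag[OF x] lin[OF chi_X chi_X] P_def by simp
  from fun_cong[OF fun_cong[OF this], of "ket y" y]
  have 2: "m {x} y * m {x} y = inv.m {y} x * m {x} y"
    using y by (simp add: P_empty chi_apply proj_singleton bops_cmult[OF P_bops] P_diag
        flip: of_real_mult)
  \<comment> \<open>If the two numbers differed, 1 would make \<open>inv.m {y} x\<close> zero and 2
    would make \<open>m {x} y\<close> zero, so they would agree.\<close>
  from 1 2 show ?thesis by (metis mult_cancel_right)
qed

text \<open>Finite additivity alone would leave room for mass at infinity. A nonzero vector fixed by
  \<open>inv.P {y}\<close> has squared coordinates at most \<open>n * m {x} y\<close>, with
  \<open>n\<close> its squared norm, so a finite set carrying most of its norm has mass nearly
  1.\<close>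

lemma m_tail:
  assumes y: "y \<in> Y" and e: "e > 0"
  shows "\<exists>F. finite F \<and> F \<subseteq> X \<and> m (X - F) y \<le> e"
proof -
  have "inv.P {y} \<noteq> inv.P {}"
  proof
    assume "inv.P {y} = inv.P {}"
    then have "chi Y {y} (ket y) y = chi Y {} (ket y) y" by (metis \<phi>_inv_P)
    then show False unfolding chi_apply[OF ket_l2[OF y]] by (simp add: proj_def ket_def)
  qed
  then obtain g where g: "inv.P {y} g \<noteq> (\<lambda>_. 0)"
    using inv.P_empty by (metis ext)
  define \<zeta> where "\<zeta> = inv.P {y} g"
  have "g \<in> l2 X" using g bops_outside[OF inv.P_bops] by blast
  then have \<zeta>: "\<zeta> \<in> l2 X" "inv.P {y} \<zeta> = \<zeta>" by (simp_all add: \<zeta>_def inv.P_P)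
  define n where "n = (l2_norm X \<zeta>)\<^sup>2"
  have n: "0 < n" using g l2_norm_eq_0[OF \<zeta>(1)] by (auto simp: n_def \<zeta>_def)
  obtain F where F: "finite F" "F \<subseteq> X" "n - e * n \<le> (\<Sum>x\<in>F. (cmod (\<zeta> x))\<^sup>2)"
    using l2_norm_approx[OF \<zeta>(1), of "e * n"] e n by (auto simp: n_def)
  have "(\<Sum>x\<in>F. (cmod (\<zeta> x))\<^sup>2) \<le> (\<Sum>x\<in>F. n * m {x} y)"
  proof (rule sum_mono)
    fix x assume "x \<in> F"
    then have x: "x \<in> X" using F by blast
    have "cmod (\<zeta> x) \<le> l2_norm X \<zeta> * sqrt (m {x} y)"
      using inv.P_coordinate_le[OF \<zeta>(1) x, of "{y}"] m_symmetric[OF x y] by (simp add: \<zeta>(2))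
    then have "(cmod (\<zeta> x))\<^sup>2 \<le> (l2_norm X \<zeta> * sqrt (m {x} y))\<^sup>2" by (intro power_mono) auto
    then show "(cmod (\<zeta> x))\<^sup>2 \<le> n * m {x} y" by (simp add: n_def power_mult_distrib m_nonneg)
  qed
  also have "\<dots> = n * m F y" unfolding m_finite[OF F(1) y] by (simp add: sum_distrib_left)
  finally have "n * (1 - e) \<le> n * m F y" using F(3) by (simp add: algebra_simps)
  then have "1 - e \<le> m F y" using n by simp
  moreover have "m X y = m F y + m (X - F) y"
    using m_union[of F "X - F" y] F(2) y by (simp add: Un_absorb1)
  ultimately show ?thesis using F m_X[OF y] by (intro exI[of _ F]) simp
qed

section \<open>Uniform quasi-locality by a category argument\<close>

lemma P_split: "P S f y = P (S \<inter> F) f y + P (S - F) f y"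
  using P_union[of "S \<inter> F" "S - F" f y] by (simp add: Int_Diff_Un Int_Diff_disjoint)

text \<open>A violation is a strict inequality, hence visible for one fixed vector on a finite set
  \<open>E\<close> of coordinates. By the tail bound these depend on \<open>S\<close>, up to a small
  error, only through a finite window \<open>F\<close>, so the violation survives for every set with
  the same trace on \<open>F\<close>.\<close>

lemma not_ql_bound_open:
  assumes S: "S \<subseteq> X" and bad: "\<not> ql_bound Y dY r e (P S)"
  shows "\<exists>F. finite F \<and> F \<subseteq> X \<and> (\<forall>T. T \<subseteq> X \<longrightarrow> T \<inter> F = S \<inter> F \<longrightarrow> \<not> ql_bound Y dY r e (P T))"
proof -
  obtain A B f where AB: "A \<subseteq> Y" "B \<subseteq> Y" "\<forall>x\<in>A. \<forall>y\<in>B. r \<le> dY x y" and f: "f \<in> l2 Y"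
    and big: "e * l2_norm Y f < l2_norm Y (proj A (P S (proj B f)))"
    using bad unfolding ql_bound_def by (auto simp: not_le)
  define \<zeta> where "\<zeta> = proj B f"
  define c where "c = e * l2_norm Y f"
  have \<zeta>: "\<zeta> \<in> l2 Y" using f by (simp add: \<zeta>_def l2_proj)
  obtain E where E: "finite E" "E \<subseteq> Y" "c < L2_set (\<lambda>y. cmod (proj A (P S \<zeta>) y)) E"
    using l2_norm_less_finite[OF l2_proj[OF P_l2[OF \<zeta>]] big[folded \<zeta>_def c_def]] by blast
  define \<gamma> where "\<gamma> = L2_set (\<lambda>y. cmod (proj A (P S \<zeta>) y)) E - c"
  \<comment> \<open>The \<open>card E\<close> coordinates change by at most \<open>2 * t\<close>
    each, in total \<open>(M - 1) * (\<gamma> / M)\<close>; the extra 1 in \<open>M\<close> makes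
    this strictly less than the margin \<gamma>.\<close>
  define M where "M = card E * (2 * l2_norm Y \<zeta>) + 1"
  have \<gamma>: "0 < \<gamma>" using E(3) by (simp add: \<gamma>_def)
  have M: "0 < M" by (simp add: M_def add_nonneg_pos)
  have "\<forall>y\<in>E. \<exists>F. finite F \<and> F \<subseteq> X \<and> m (X - F) y \<le> (\<gamma> / M)\<^sup>2"
    using m_tail[of _ "(\<gamma> / M)\<^sup>2"] E(2) \<gamma> M by auto
  then obtain \<F> where \<F>: "\<And>y. y \<in> E \<Longrightarrow> finite (\<F> y) \<and> \<F> y \<subseteq> X \<and> m (X - \<F> y) y \<le> (\<gamma> / M)\<^sup>2"
    by metis
  define F where "F = (\<Union>y\<in>E. \<F> y)"
  have F: "finite F" "F \<subseteq> X" using E(1) \<F> by (auto simp: F_def)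
  define t where "t = l2_norm Y \<zeta> * (\<gamma> / M)"
  have t: "0 \<le> t" using \<gamma> M by (simp add: t_def)
  have small: "cmod (P (T - F) \<zeta> y) \<le> t" if "T \<subseteq> X" "y \<in> E" for T y
  proof -
    have y: "y \<in> Y" using E(2) that by blast
    have "m (T - F) y \<le> m (X - \<F> y) y"
      using that by (intro m_mono y) (auto simp: F_def)
    also have "\<dots> \<le> (\<gamma> / M)\<^sup>2" using \<F> that by blast
    finally have "sqrt (m (T - F) y) \<le> \<gamma> / M" using \<gamma> M by (intro real_le_lsqrt) (auto simp: m_nonneg)
    then have "l2_norm Y \<zeta> * sqrt (m (T - F) y) \<le> t"
      unfolding t_def by (intro mult_left_mono) auto
    then show ?thesis using P_coordinate_le[OF \<zeta> y, of "T - F"] by linarith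
  qed
  have "\<not> ql_bound Y dY r e (P T)" if T: "T \<subseteq> X" "T \<inter> F = S \<inter> F" for T
  proof
    assume "ql_bound Y dY r e (P T)"
    then have "l2_norm Y (proj A (P T \<zeta>)) \<le> c"
      unfolding \<zeta>_def c_def using AB f by (intro ql_boundD[of Y dY r]) auto
    then have le_c: "L2_set (\<lambda>y. cmod (proj A (P T \<zeta>) y)) E \<le> c"
      using L2_set_le_l2_norm[OF l2_proj[OF P_l2[OF \<zeta>]] E(1,2), of A T] by linarith
    define D where "D y = proj A (P S \<zeta>) y - proj A (P T \<zeta>) y" for y
    have D: "cmod (D y) \<le> 2 * t" if y: "y \<in> E" for y
    proof -
      have "P S \<zeta> y - P T \<zeta> y = P (S - F) \<zeta> y - P (T - F) \<zeta> y"
        using P_split[of S \<zeta> y F] P_split[of T \<zeta> y F] T(2) by simp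
      then have "cmod (P S \<zeta> y - P T \<zeta> y) \<le> 2 * t"
        using small[OF S y] small[OF T(1) y] norm_triangle_ineq4[of "P (S - F) \<zeta> y" "P (T - F) \<zeta> y"]
        by simp
      then show ?thesis using t by (simp add: D_def proj_def)
    qed
    have "c + \<gamma> = L2_set (\<lambda>y. cmod (proj A (P S \<zeta>) y)) E" by (simp add: \<gamma>_def)
    also have "\<dots> \<le> L2_set (\<lambda>y. cmod (proj A (P T \<zeta>) y) + cmod (D y)) E"
    proof (rule L2_set_mono)
      fix y
      show "cmod (proj A (P S \<zeta>) y) \<le> cmod (proj A (P T \<zeta>) y) + cmod (D y)"
        using norm_triangle_ineq[of "proj A (P T \<zeta>) y" "D y"] by (simp add: D_def)
    qed simp
    also have "\<dots> \<le> L2_set (\<lambda>y. cmod (proj A (P T \<zeta>) y)) E + L2_set (\<lambda>y. cmod (D y)) E"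
      by (rule L2_set_triangle_ineq)
    also have "\<dots> \<le> c + (\<Sum>y\<in>E. cmod (D y))"
      using le_c L2_set_le_sum_abs[of "\<lambda>y. cmod (D y)" E] by simp
    also have "\<dots> \<le> c + card E * (2 * t)"
      using sum_mono[OF D] by simp
    also have "\<dots> = c + (M - 1) * (\<gamma> / M)" by (simp add: M_def t_def)
    also have "\<dots> < c + \<gamma>" using M \<gamma> by (simp add: field_simps)
    finally show False by simp
  qed
  then show ?thesis using F by blast
qed

text \<open>A Baire category argument on the space of all subsets of \<^term>\<open>X\<close>: quasi-locality at a
  given scale is a closed condition, so some scale works for all sets with a fixed pattern on a
  finite set, and finitely many corrections remove the pattern.\<close>

lemma P_uniformly_quasi_local:
  assumes e: "e > 0"
  shows "\<exists>r>0. \<forall>S\<subseteq>X. ql_bound Y dY r e (P S)"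
proof -
  \<comment> \<open>One third of \<open>e\<close>, since \<open>P S\<close> will be a combination of
    three operators.\<close>
  define good where "good k S \<longleftrightarrow> ql_bound Y dY (real k) (e / 3) (P S)" for k S
  have e3: "0 < e / 3" using e by simp
  have pattern: "\<exists>k F S0. finite F \<and> (\<forall>S\<subseteq>X. S \<inter> F = S0 \<longrightarrow> good k S) \<and> S0 \<subseteq> F \<and> F \<subseteq> X"
  proof (rule ccontr)
    assume neg: "\<not> ?thesis"
    have step: "\<exists>G U. finite G \<and> G \<subseteq> X \<and> U \<subseteq> G \<and> (\<forall>S\<subseteq>X. S \<inter> G = U \<longrightarrow> \<not> good n S) \<and> F \<subseteq> G \<and> U \<inter> F = T"
      if F: "finite F" "F \<subseteq> X" "T \<subseteq> F" for n F T
    proof -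
      have "\<not> (finite F \<and> (\<forall>S\<subseteq>X. S \<inter> F = T \<longrightarrow> good n S) \<and> T \<subseteq> F \<and> F \<subseteq> X)"
        using neg by blast
      then obtain S where S: "S \<subseteq> X" "S \<inter> F = T" "\<not> good n S" using F by auto
      have "\<exists>F1. finite F1 \<and> F1 \<subseteq> X \<and> (\<forall>T. T \<subseteq> X \<longrightarrow> T \<inter> F1 = S \<inter> F1 \<longrightarrow> \<not> good n T)"
        using not_ql_bound_open[OF S(1) S(3)[unfolded good_def]] unfolding good_def .
      then obtain F1 where F1: "finite F1" "F1 \<subseteq> X" "\<And>T. T \<subseteq> X \<Longrightarrow> T \<inter> F1 = S \<inter> F1 \<Longrightarrow> \<not> good n T"
        by auto
      define G where "G = F \<union> F1"
      have G: "finite G" "G \<subseteq> X" "S \<inter> G \<subseteq> G" "F \<subseteq> G" "S \<inter> G \<inter> F = T"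
        using F F1(1,2) S(2) by (auto simp: G_def)
      have bad: "\<forall>S'\<subseteq>X. S' \<inter> G = S \<inter> G \<longrightarrow> \<not> good n S'"
      proof (intro allI impI)
        fix S' assume "S' \<subseteq> X" "S' \<inter> G = S \<inter> G"
        then show "\<not> good n S'" by (intro F1(3)) (auto simp: G_def)
      qed
      show ?thesis
        by (intro exI[of _ G] exI[of _ "S \<inter> G"] conjI G bad)
    qed
    \<comment> \<open>A pair holds a finite window and a prescribed trace on it such that no set
      with this trace is good at scale \<open>n\<close>. The union of the nested traces is good at
      no scale, contrary to quasi-locality of its image.\<close>
    define ok where "ok n p \<longleftrightarrow> finite (fst p) \<and> fst p \<subseteq> X \<and> snd p \<subseteq> fst p \<and>
        (\<forall>S\<subseteq>X. S \<inter> fst p = snd p \<longrightarrow> \<not> good n S)" for n and p :: "'a set \<times> 'a set"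
    have "\<exists>st. \<forall>n. ok n (st n) \<and> (fst (st n) \<subseteq> fst (st (Suc n)) \<and> snd (st (Suc n)) \<inter> fst (st n) = snd (st n))"
    proof (rule dependent_nat_choice)
      show "\<exists>p. ok 0 p" using step[of "{}" "{}" 0] by (auto simp: ok_def)
      fix p n assume "ok n p"
      then show "\<exists>q. ok (Suc n) q \<and> fst p \<subseteq> fst q \<and> snd q \<inter> fst p = snd p"
        using step[of "fst p" "snd p" "Suc n"] unfolding ok_def by auto
    qed
    then obtain st where st: "\<And>n. ok n (st n)"
      and Fmono: "\<And>n. fst (st n) \<subseteq> fst (st (Suc n))"
      and Tstep: "\<And>n. snd (st (Suc n)) \<inter> fst (st n) = snd (st n)" by blast
    have F_mono: "fst (st n) \<subseteq> fst (st k)" if "n \<le> k" for n k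
      using Fmono that by (rule lift_Suc_mono_le)
    have T_mono: "snd (st n) \<subseteq> snd (st k)" if "n \<le> k" for n k
    proof (rule lift_Suc_mono_le[OF _ that])
      show "snd (st n) \<subseteq> snd (st (Suc n))" for n using Tstep[of n] by blast
    qed
    have T_restrict: "snd (st k) \<inter> fst (st n) \<subseteq> snd (st n)" if "n \<le> k" for n k
      using that
    proof (induction k rule: dec_induct)
      case (step k)
      then show ?case using Tstep[of k] F_mono[of n k] by blast
    qed blast
    define S where "S = (\<Union>n. snd (st n))"
    have S: "S \<subseteq> X" using st by (fastforce simp: S_def ok_def)
    have "S \<inter> fst (st n) = snd (st n)" for n
    proof
      show "S \<inter> fst (st n) \<subseteq> snd (st n)"
      proof
        fix x assume x: "x \<in> S \<inter> fst (st n)"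
        then obtain k where k: "x \<in> snd (st k)" by (auto simp: S_def)
        show "x \<in> snd (st n)"
          using T_mono[of k n] T_restrict[of n k] x k by (cases "k \<le> n") auto
      qed
      show "snd (st n) \<subseteq> S \<inter> fst (st n)" using st[of n] by (auto simp: S_def ok_def)
    qed
    then have bad: "\<not> good n S" for n using st[of n] S unfolding ok_def by blast
    obtain r where r: "r > 0" "ql_bound Y dY r (e / 3) (P S)"
      using Cql_ql_bound[OF P_Cql e3] by blast
    obtain n where "r \<le> real n" using real_arch_simple by blast
    then have "good n S" unfolding good_def by (intro ql_bound_mono[OF r(2)]) simp_all
    then show False using bad by blast
  qed
  then obtain k F S0 where F: "finite F" "F \<subseteq> X" "S0 \<subseteq> F"
    and good: "\<And>S. S \<subseteq> X \<Longrightarrow> S \<inter> F = S0 \<Longrightarrow> good k S" by blast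
  obtain \<rho> where \<rho>: "\<And>S. ql_bound Y dY (\<rho> S) (e / 3) (P S)"
    using Cql_ql_bound[OF P_Cql e3] by metis
  \<comment> \<open>One scale for the pattern and for the finitely many subsets of \<open>F\<close>;
    the 1 ensures positivity.\<close>
  define R where "R = Max (insert 1 (insert (real k) (\<rho> ` Pow F)))"
  have fin: "finite (insert 1 (insert (real k) (\<rho> ` Pow F)))" using F(1) by simp
  have R: "1 \<le> R" "real k \<le> R" "\<And>T. T \<subseteq> F \<Longrightarrow> \<rho> T \<le> R"
    unfolding R_def by (rule Max_ge[OF fin], blast)+
  have "ql_bound Y dY R e (P S)" if S: "S \<subseteq> X" for S
  proof -
    \<comment> \<open>Exchanging the trace of \<open>S\<close> on \<open>F\<close> for
      \<open>S0\<close> gives a good set, and \<open>P S\<close> equals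
      \<open>P S' - P S0 + P (S \<inter> F)\<close>.\<close>
    define S' where "S' = (S - F) \<union> S0"
    have "S' \<subseteq> X" "S' \<inter> F = S0" using S F by (auto simp: S'_def)
    then have 1: "ql_bound Y dY R (e / 3) (P S')"
      using good[of S'] R(2) unfolding good_def by (auto intro: ql_bound_mono)
    have 2: "ql_bound Y dY R (e / 3) (P S0)" "ql_bound Y dY R (e / 3) (P (S \<inter> F))"
      using R(3) F(3) by (auto intro!: ql_bound_mono[OF \<rho>])
    define a where "a = (\<lambda>f y. (- 1) * P S0 f y + P S' f y)"
    have a: "a \<in> bops Y" unfolding a_def by (intro bops_lincomb P_bops)
    have "ql_bound Y dY R (cmod (- 1) * (e / 3) + e / 3) a"
      unfolding a_def by (intro ql_bound_lincomb P_bops 1 2)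
    from ql_bound_lincomb[OF a this P_bops 2(2), of 1]
    have "ql_bound Y dY R e (\<lambda>f y. 1 * a f y + P (S \<inter> F) f y)" by simp
    moreover have "(\<lambda>f y. 1 * a f y + P (S \<inter> F) f y) = P S"
    proof (intro ext)
      fix f y
      have "P S' f y = P (S - F) f y + P S0 f y"
        unfolding S'_def using F(3) by (intro P_union) blast
      then show "1 * a f y + P (S \<inter> F) f y = P S f y"
        using P_split[of S f y F] by (simp add: a_def)
    qed
    ultimately show ?thesis by simp
  qed
  then show ?thesis using R(1) by (intro exI[of _ R]) auto
qed

section \<open>Large entries and coarse control\<close>

lemma l2_inner_P_disjoint:
  assumes "f \<in> l2 Y" "g \<in> l2 Y" "S \<inter> T = {}"
  shows "l2_inner Y (P S f) (P T g) = 0"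
proof -
  have "P S (P T g) = (\<lambda>_. 0)" using assms(3) by (simp add: P_P P_empty fun_eq_iff)
  then show ?thesis using assms P_self_adjoint[of f "P T g" S] by (simp add: l2_inner_def)
qed

text \<open>Were all entries at \<open>y\<close> at most \<open>c\<close>, suitable signs would make
  the signed vector \<open>w\<close> small on the ball \<open>B\<close>, since the bounds
  \<open>m {x} y * m {x} z \<le> c * m {x} z\<close> sum to at most \<open>card B * c\<close>. But
  the norm of \<open>w\<close> does not depend on the signs, and quasi-locality leaves only a small
  part of it outside \<open>B\<close>.\<close>

lemma exists_large_entry:
  "\<exists>c>0. \<forall>y\<in>Y. \<exists>x\<in>X. c \<le> m {x} y"
proof -
  interpret MY: Metric_space Y dY by (rule mY)
  obtain r where r: "r > 0" "\<And>S. S \<subseteq> X \<Longrightarrow> ql_bound Y dY r (1 / 8) (P S)"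
    using P_uniformly_quasi_local[of "1 / 8"] by auto
  obtain N :: nat where N: "\<And>y. y \<in> Y \<Longrightarrow> finite {z \<in> Y. dY y z \<le> r} \<and> card {z \<in> Y. dY y z \<le> r} \<le> N"
    using ulfY[unfolded ulf_def, rule_format, OF r(1)] by blast
  \<comment> \<open>Makes \<open>N * c < 1 / 4\<close>. Against this, \<open>w\<close> has norm at
    least 3/4 and at most 1/8 + 1/8 outside \<open>B\<close>, hence squared norm at least 1/4 on
    \<open>B\<close>.\<close>
  define c where "c = 1 / (8 * (real N + 1))"
  have c: "c > 0" by (simp add: c_def)
  have "\<exists>x\<in>X. c \<le> m {x} y" if y: "y \<in> Y" for y
  proof (rule ccontr)
    assume "\<not> ?thesis"
    then have less: "m {x} y \<le> c" if "x \<in> X" for x using that by force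
    define B where "B = {z \<in> Y. dY y z \<le> r}"
    have B: "finite B" "B \<subseteq> Y" "card B \<le> N" using N[OF y] by (auto simp: B_def)
    obtain A where A: "finite A" "A \<subseteq> X" "m (X - A) y \<le> 1 / 4"
      using m_tail[OF y, of "1 / 4"] by auto
    have mA: "3 / 4 \<le> m A y"
      using m_union[of A "X - A" y] A y m_X[OF y] by (simp add: Un_absorb1)
    obtain S where S: "(\<Sum>z\<in>B. (cmod ((\<Sum>x\<in>A \<inter> S. P {x} (ket y) z) - (\<Sum>x\<in>A - S. P {x} (ket y) z)))\<^sup>2)
        \<le> (\<Sum>x\<in>A. \<Sum>z\<in>B. (cmod (P {x} (ket y) z))\<^sup>2)"
      using exists_signs_le[OF A(1), where B = B and v = "\<lambda>x. P {x} (ket y)"] by blast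
    define w where "w = (\<lambda>z. P (A \<inter> S) (ket y) z - P (A - S) (ket y) z)"
    have w: "w \<in> l2 Y" using y by (simp add: w_def l2_diff)
    have "(\<Sum>z\<in>B. (cmod (w z))\<^sup>2) \<le> (\<Sum>x\<in>A. \<Sum>z\<in>B. (cmod (P {x} (ket y) z))\<^sup>2)"
      using S A(1) P_finite[of "A \<inter> S" "ket y"] P_finite[of "A - S" "ket y"] by (simp add: w_def)
    also have "\<dots> \<le> (\<Sum>x\<in>A. \<Sum>z\<in>B. c * m {x} z)"
    proof (intro sum_mono)
      fix x z assume xz: "x \<in> A" "z \<in> B"
      then have "(cmod (P {x} (ket y) z))\<^sup>2 \<le> m {x} y * m {x} z"
        using B(2) y by (intro P_entry_le) auto
      also have "\<dots> \<le> c * m {x} z" using less A(2) xz by (intro mult_right_mono m_nonneg) auto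
      finally show "(cmod (P {x} (ket y) z))\<^sup>2 \<le> c * m {x} z" .
    qed
    also have "\<dots> = (\<Sum>z\<in>B. c * m A z)"
    proof -
      have "(\<Sum>x\<in>A. \<Sum>z\<in>B. c * m {x} z) = (\<Sum>z\<in>B. \<Sum>x\<in>A. c * m {x} z)" by (rule sum.swap)
      also have "\<dots> = (\<Sum>z\<in>B. c * m A z)"
      proof (rule sum.cong[OF refl])
        fix z assume "z \<in> B"
        then have "z \<in> Y" using B(2) by blast
        then show "(\<Sum>x\<in>A. c * m {x} z) = c * m A z"
          unfolding m_finite[OF A(1) \<open>z \<in> Y\<close>] by (simp add: sum_distrib_left)
      qed
      finally show ?thesis .
    qed
    also have "\<dots> \<le> (\<Sum>z\<in>B. c)"
      using c A(2) B(2) by (intro sum_mono) (auto intro!: mult_left_le m_le_1)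
    also have "\<dots> \<le> real N * c" using B(3) c by (simp add: mult_right_mono)
    also have "\<dots> < 1 / 4" by (simp add: c_def field_simps)
    finally have up: "(\<Sum>z\<in>B. (cmod (w z))\<^sup>2) < 1 / 4" .
    have "(l2_norm Y w)\<^sup>2 = m A y"
    proof -
      have "(l2_norm Y (\<lambda>z. P (A \<inter> S) (ket y) z + (- 1) * P (A - S) (ket y) z))\<^sup>2
          = (l2_norm Y (P (A \<inter> S) (ket y)))\<^sup>2 + (l2_norm Y (\<lambda>z. (- 1) * P (A - S) (ket y) z))\<^sup>2"
      proof (rule l2_norm_Pythagoras)
        show "l2_inner Y (P (A \<inter> S) (ket y)) (\<lambda>z. (- 1) * P (A - S) (ket y) z) = 0"
          unfolding l2_inner_cmult_right using y by (subst l2_inner_P_disjoint) auto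
        show "P (A \<inter> S) (ket y) \<in> l2 Y" "(\<lambda>z. (- 1) * P (A - S) (ket y) z) \<in> l2 Y"
          using y by (simp, intro l2_cmult, simp)
      qed
      then have "(l2_norm Y w)\<^sup>2 = m (A \<inter> S) y + m (A - S) y"
        unfolding l2_norm_cmult by (simp add: w_def m_def)
      also have "\<dots> = m A y"
        using m_union[of "A \<inter> S" "A - S" y] y by (simp add: Int_Diff_Un Int_Diff_disjoint)
      finally show ?thesis .
    qed
    then have norm_w: "3 / 4 \<le> l2_norm Y w"
      using mA by (intro power2_le_imp_le[of "3 / 4"]) (auto simp: power2_eq_square)
    have far: "l2_norm Y (proj (Y - B) (P T (ket y))) \<le> 1 / 8" if "T \<subseteq> X" for T
    proof -
      have "proj {y} (ket y) = ket y" by (auto simp: proj_def ket_def)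
      moreover have "l2_norm Y (proj (Y - B) (P T (proj {y} (ket y)))) \<le> 1 / 8 * l2_norm Y (ket y)"
        using y by (intro ql_boundD[OF r(2)[OF that]]) (auto simp: B_def MY.commute[of _ y])
      ultimately show ?thesis using y by simp
    qed
    have "l2_norm Y (proj (Y - B) w) \<le> 1 / 4"
    proof -
      have "proj (Y - B) w = (\<lambda>z. proj (Y - B) (P (A \<inter> S) (ket y)) z - proj (Y - B) (P (A - S) (ket y)) z)"
        by (auto simp: proj_def w_def)
      then have "l2_norm Y (proj (Y - B) w)
          \<le> l2_norm Y (proj (Y - B) (P (A \<inter> S) (ket y))) + l2_norm Y (proj (Y - B) (P (A - S) (ket y)))"
        using y by (simp add: l2_norm_triangle_diff l2_proj)
      moreover have "A \<inter> S \<subseteq> X" "A - S \<subseteq> X" using A(2) by blast+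
      ultimately show ?thesis using far[of "A \<inter> S"] far[of "A - S"] by linarith
    qed
    moreover have "w = (\<lambda>z. proj B w z + proj (Y - B) w z)"
      using l2_outside[OF w] by (auto simp: proj_def fun_eq_iff)
    then have "l2_norm Y w \<le> l2_norm Y (proj B w) + l2_norm Y (proj (Y - B) w)"
      using l2_norm_triangle[OF l2_proj[OF w, of B] l2_proj[OF w, of "Y - B"]] by simp
    ultimately have "1 / 2 \<le> l2_norm Y (proj B w)" using norm_w by linarith
    then have "(1 / 2)\<^sup>2 \<le> (l2_norm Y (proj B w))\<^sup>2" by (intro power_mono) auto
    also have "\<dots> = (\<Sum>z\<in>B. (cmod (w z))\<^sup>2)"
      by (simp add: l2_proj_finite[OF B(1,2)] L2_set_def sum_nonneg)
    finally show False using up by (simp add: power2_eq_square)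
  qed
  then show ?thesis using c by blast
qed

text \<open>The matrix units \<open>U x x'\<close> and \<open>U x' x\<close> turn the preimage of
  \<open>chi Y {y'}\<close> into \<open>m {x'} y'\<close> times \<open>chi X {x}\<close>. Applying
  \<phi> and reading the diagonal entry at \<open>y\<close> expresses
  \<open>m {x'} y' * m {x} y\<close>, at least \<open>c * c\<close>, as a product of two matrix
  entries between \<open>y\<close> and \<open>y'\<close>, and such entries are small at large
  distance.\<close>

lemma near_entries:
  assumes c: "c > 0" and s: "s > 0"
  shows "\<exists>k>0. \<forall>x\<in>X. \<forall>x'\<in>X. \<forall>y\<in>Y. \<forall>y'\<in>Y.
      dX x x' \<le> s \<longrightarrow> c \<le> m {x} y \<longrightarrow> c \<le> m {x'} y' \<longrightarrow> dY y y' \<le> k"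
proof -
  interpret MX: Metric_space X dX by (rule mX)
  interpret MY: Metric_space Y dY by (rule mY)
  define v where "v = band_op X dX s"
  have v: "v \<in> Cql X dX" unfolding v_def by (rule band_op_Cql[OF mX ulfX s])
  define V where "V = \<phi> v"
  have V: "V \<in> Cql Y dY" "V \<in> bops Y" using \<phi>_Cql[OF v] Cql_bops by (auto simp: V_def)
  obtain K where K: "0 \<le> K" "\<And>f. f \<in> l2 Y \<Longrightarrow> l2_norm Y (V f) \<le> K * l2_norm Y f"
    using bops_bound[OF V(2)] by blast
  \<comment> \<open>Solves \<open>e * (1 + 2 * K) = c / 2\<close>, the tolerance that the two
    compositions in \<open>W\<close> accumulate; each also doubles the scale, whence
    \<open>4 * R\<close>.\<close>
  define e where "e = c / (2 * (1 + 2 * K))"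
  have e: "e > 0" using c K(1) by (simp add: e_def)
  obtain r1 where r1: "r1 > 0" "\<And>S. S \<subseteq> X \<Longrightarrow> ql_bound Y dY r1 e (P S)"
    using P_uniformly_quasi_local[OF e] by blast
  obtain r2 where r2: "r2 > 0" "ql_bound Y dY r2 e V" using Cql_ql_bound[OF V(1) e] by blast
  define R where "R = max r1 r2"
  have R: "R > 0" "r1 \<le> R" "r2 \<le> R" using r1(1) by (auto simp: R_def)
  \<comment> \<open>All \<open>W x x'\<close> share the same \<open>V\<close>, so they are
    quasi-local at one scale; this is the purpose of the band operator.\<close>
  define W where "W x x' = P {x} \<circ> (V \<circ> P {x'})" for x x'
  have W_bops: "W x x' \<in> bops Y" for x x'
    unfolding W_def by (intro bops_comp P_bops V)
  have W_ql: "ql_bound Y dY (4 * R) (c / 2) (W x x')" if "x \<in> X" "x' \<in> X" for x x'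
  proof -
    have VP: "ql_bound Y dY (2 * R) (e * 1 + K * e) (V \<circ> P {x'})"
    proof (rule ql_bound_comp[OF mY V(2) _ K(2,1) P_bops])
      show "ql_bound Y dY R e V" using r2(2) R(3) by (rule ql_bound_mono) simp
      show "ql_bound Y dY R e (P {x'})" using r1(2)[of "{x'}"] R(2) that by (auto intro: ql_bound_mono)
    qed (use e l2_norm_P_le in auto)
    have "ql_bound Y dY (2 * (2 * R)) (e * K + 1 * (e * 1 + K * e)) (W x x')"
      unfolding W_def
    proof (rule ql_bound_comp[OF mY P_bops _ _ _ bops_comp[OF V(2) P_bops] VP])
      show "ql_bound Y dY (2 * R) e (P {x})"
        using r1(2)[of "{x}"] R(1,2) that by (auto intro: ql_bound_mono)
      fix f assume f: "f \<in> l2 Y"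
      show "l2_norm Y (P {x} f) \<le> 1 * l2_norm Y f" using l2_norm_P_le[OF f] by simp
      have "l2_norm Y (V (P {x'} f)) \<le> K * l2_norm Y (P {x'} f)" using f by (intro K(2)) simp
      also have "\<dots> \<le> K * l2_norm Y f" using K(1) l2_norm_P_le[OF f] by (intro mult_left_mono)
      finally show "l2_norm Y ((V \<circ> P {x'}) f) \<le> K * l2_norm Y f" by simp
    qed (use e in auto)
    moreover have "e * K + 1 * (e * 1 + K * e) = c / 2"
    proof -
      have "e * K + 1 * (e * 1 + K * e) = e * (1 + 2 * K)" by (simp add: algebra_simps)
      also have "\<dots> = c / 2" using K(1) unfolding e_def by (simp add: divide_simps)
      finally show ?thesis .
    qed
    moreover have "2 * (2 * R) = 4 * R" by simp
    ultimately show ?thesis by metis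
  qed
  have "dY y y' \<le> 4 * R"
    if x: "x \<in> X" "x' \<in> X" and y: "y \<in> Y" "y' \<in> Y" and d: "dX x x' \<le> s"
      and cm: "c \<le> m {x} y" "c \<le> m {x'} y'" for x x' y y'
  proof (rule ccontr)
    assume "\<not> ?thesis"
    then have far: "4 * R \<le> dY y y'" "4 * R \<le> dY y' y" using MY.commute[of y y'] by auto
    \<comment> \<open>A matrix unit when \<open>dX u u' \<le> s\<close>, since the corresponding
      entry of \<open>v\<close> is 1.\<close>
    define U where "U u u' = chi X {u} \<circ> (v \<circ> chi X {u'})" for u u'
    have U_Cql: "U u u' \<in> Cql X dX" for u u'
      unfolding U_def by (intro Cql_comp mX chi_X v)
    have \<phi>_U: "\<phi> (U u u') = W u u'" for u u'
      unfolding U_def W_def P_def V_def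
      using mult[OF chi_X Cql_comp[OF mX v chi_X]] mult[OF v chi_X] by simp
    have U_apply: "U u u' f = (\<lambda>z. f u' * ket u z)"
      if u: "u \<in> X" "u' \<in> X" "dX u u' \<le> s" and f: "f \<in> l2 X" for u u' f
    proof -
      have g: "(\<lambda>z. f u' * ket u' z) \<in> l2 X" using u by (simp add: l2_cmult)
      have "v (\<lambda>z. f u' * ket u' z) u = (\<Sum>z\<in>{z \<in> X. dX u z \<le> s}. f u' * ket u' z)"
        using g u by (simp add: v_def band_op_def)
      also have "\<dots> = (\<Sum>z\<in>{z \<in> X. dX u z \<le> s}. if z = u' then f u' else 0)"
        by (intro sum.cong) (auto simp: ket_def)
      also have "\<dots> = f u'"
      proof -
        have "finite {z \<in> X. dX u z \<le> s}" using ulfX[unfolded ulf_def, rule_format, OF s] u(1) by blast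
        then show ?thesis using u by simp
      qed
      finally show ?thesis
        using f bops_l2[OF Cql_bops[OF v] g] by (simp add: U_def chi_apply proj_singleton)
    qed
    have d': "dX x' x \<le> s" using d by (simp add: MX.commute)
    define \<mu> where "\<mu> = complex_of_real (m {x'} y')"
    have eq: "U x x' \<circ> (inv.P {y'} \<circ> U x' x) = (\<lambda>f z. \<mu> * chi X {x} f z + chi X {} f z)"
    proof
      fix f
      show "(U x x' \<circ> (inv.P {y'} \<circ> U x' x)) f = (\<lambda>z. \<mu> * chi X {x} f z + chi X {} f z)"
      proof (cases "f \<in> l2 X")
        case True
        have "inv.P {y'} (U x' x f) = (\<lambda>z. f x * inv.P {y'} (ket x') z)"
          unfolding U_apply[OF x(2,1) d' True] using x by (simp add: bops_cmult[OF inv.P_bops])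
        moreover have "inv.P {y'} (ket x') x' = \<mu>"
          using x y by (simp add: inv.P_diag m_symmetric \<mu>_def)
        moreover have "inv.P {y'} (U x' x f) \<in> l2 X"
          using True bops_l2[OF Cql_bops[OF U_Cql]] by simp
        ultimately show ?thesis
          using U_apply[OF x d, of "inv.P {y'} (U x' x f)"] True
          by (simp add: chi_apply proj_singleton fun_eq_iff) (simp add: proj_def)
      next
        case False
        then show ?thesis
          using bops_zero[OF inv.P_bops] bops_zero[OF Cql_bops[OF U_Cql]] bops_outside[OF Cql_bops[OF U_Cql] False]
          by (simp add: chi_def)
      qed
    qed
    have "\<phi> (U x x' \<circ> (inv.P {y'} \<circ> U x' x)) = W x x' \<circ> (chi Y {y'} \<circ> W x' x)"
      using mult[OF U_Cql Cql_comp[OF mX inv.P_Cql U_Cql]] mult[OF inv.P_Cql U_Cql]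
      by (simp add: \<phi>_U \<phi>_inv_P)
    then have "W x x' \<circ> (chi Y {y'} \<circ> W x' x) = (\<lambda>f z. \<mu> * P {x} f z + P {} f z)"
      unfolding eq lin[OF chi_X chi_X] P_def by simp
    from fun_cong[OF fun_cong[OF this], of "ket y" y]
    have "W x' x (ket y) y' * W x x' (ket y') y = \<mu> * complex_of_real (m {x} y)"
      using y bops_l2[OF W_bops, of "ket y" x' x]
      by (simp add: P_empty P_diag chi_apply proj_singleton bops_cmult[OF W_bops])
    then have "cmod (W x' x (ket y) y') * cmod (W x x' (ket y') y) = m {x'} y' * m {x} y"
      by (simp add: \<mu>_def m_nonneg flip: norm_mult) (simp add: norm_mult m_nonneg)
    moreover have "c * c \<le> m {x'} y' * m {x} y" using cm c by (intro mult_mono) auto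
    moreover have "cmod (W x' x (ket y) y') * cmod (W x x' (ket y') y) \<le> c / 2 * (c / 2)"
      using far x y c
      by (intro mult_mono cmod_entry_le[OF W_bops W_ql]) auto
    ultimately have "c * c \<le> c * c / 4" by simp
    then show False using c by simp
  qed
  then show ?thesis using R(1) by (intro exI[of _ "4 * R"]) auto
qed

section \<open>Hall's condition with a uniform radius\<close>

lemma P_orthogonal_combination:
  assumes "finite A" "\<And>x. x \<in> A \<Longrightarrow> g x \<in> l2 Y"
  shows "P T (\<lambda>y. \<Sum>x\<in>A. a x * P {x} (g x) y) = (\<lambda>y. \<Sum>x\<in>A \<inter> T. a x * P {x} (g x) y)"
proof -
  have "P T (\<lambda>y. \<Sum>x\<in>A. a x * P {x} (g x) y) = (\<lambda>y. \<Sum>x\<in>A. a x * P (T \<inter> {x}) (g x) y)"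
    using assms by (simp add: bops_sum[OF P_bops] l2_cmult bops_cmult[OF P_bops] P_P)
  also have "\<dots> = (\<lambda>y. \<Sum>x\<in>A \<inter> T. a x * P {x} (g x) y)"
    using assms(1) by (intro ext sum.mono_neutral_cong_right) (auto simp: P_empty)
  finally show ?thesis .
qed

lemma l2_norm_orthogonal_combination:
  assumes "finite A" "\<And>x. x \<in> A \<Longrightarrow> g x \<in> l2 Y"
  shows "(l2_norm Y (\<lambda>y. \<Sum>x\<in>A. a x * P {x} (g x) y))\<^sup>2
    = (\<Sum>x\<in>A. (cmod (a x))\<^sup>2 * (l2_norm Y (P {x} (g x)))\<^sup>2)"
  using assms
proof (induction A)
  case (insert x A)
  define h where "h = (\<lambda>y. \<Sum>x\<in>A. a x * P {x} (g x) y)"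
  have h: "h \<in> l2 Y" unfolding h_def using insert.prems by (intro l2_sum l2_cmult P_l2) simp
  have "P {x} h = (\<lambda>_. 0)"
    unfolding h_def using insert by (subst P_orthogonal_combination) auto
  then have "l2_inner Y (\<lambda>y. a x * P {x} (g x) y) h = 0"
    using h insert.prems P_self_adjoint[of "g x" h "{x}"] by (simp add: l2_inner_cmult) (simp add: l2_inner_def)
  then have "(l2_norm Y (\<lambda>y. a x * P {x} (g x) y + h y))\<^sup>2
      = (l2_norm Y (\<lambda>y. a x * P {x} (g x) y))\<^sup>2 + (l2_norm Y h)\<^sup>2"
    using h insert.prems by (intro l2_norm_Pythagoras) (auto intro: l2_cmult)
  then show ?case
    using insert by (simp add: h_def l2_norm_cmult power_mult_distrib)
qed simp

text \<open>The radius precedes \<open>f\<close> and \<open>A\<close> because it depends only on the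
  tolerance \<open>c / 4\<close>. Two pieces of the signed vector add up to \<open>c / 2\<close>, so
  its squared mass on \<open>E\<close> is at most \<open>c\<^sup>2 * q / 4\<close>, whereas the
  signs push at least \<open>c\<^sup>2 * q\<close> there.\<close>

lemma Hall_condition:
  assumes c: "c > 0"
  shows "\<exists>k>0. \<forall>f. (\<forall>x\<in>X. f x \<in> Y \<and> c \<le> m {x} (f x)) \<longrightarrow>
    (\<forall>A. finite A \<longrightarrow> A \<subseteq> X \<longrightarrow> card A \<le> card (\<Union>x\<in>A. {y \<in> Y. dY (f x) y \<le> k}))"
proof -
  obtain r where r: "r > 0" "\<And>S. S \<subseteq> X \<Longrightarrow> ql_bound Y dY r (c / 4) (P S)"
    using P_uniformly_quasi_local[of "c / 4"] c by auto
  have "card A \<le> card (\<Union>x\<in>A. {y \<in> Y. dY (f x) y \<le> r})"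
    if f: "\<forall>x\<in>X. f x \<in> Y \<and> c \<le> m {x} (f x)" and A: "finite A" "A \<subseteq> X" for f A
  proof (rule ccontr)
    define N where "N = (\<Union>x\<in>A. {y \<in> Y. dY (f x) y \<le> r})"
    assume "\<not> ?thesis"
    then have less: "card N < card A" by (simp add: N_def)
    have fA: "f x \<in> Y" "c \<le> m {x} (f x)" if "x \<in> A" for x using f A that by auto
    have N: "finite N"
      unfolding N_def using A fA ulfY[unfolded ulf_def, rule_format, OF r(1)] by blast
    obtain a where a: "\<exists>x\<in>A. a x \<noteq> 0" "\<And>y. y \<in> N \<Longrightarrow> (\<Sum>x\<in>A. a x * P {x} (ket (f x)) y) = 0"
      using underdetermined_system_nontrivial_solution[OF N A(1) less, of "\<lambda>x. P {x} (ket (f x))"] by blast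
    define \<xi> where "\<xi> = (\<lambda>y. \<Sum>x\<in>A. a x * P {x} (ket (f x)) y)"
    have \<xi>: "\<xi> \<in> l2 Y" unfolding \<xi>_def using fA by (intro l2_sum l2_cmult P_l2 ket_l2)
    have supp: "proj (Y - N) \<xi> = \<xi>"
      using a(2) l2_outside[OF \<xi>] by (auto simp: proj_def fun_eq_iff \<xi>_def)
    define q where "q = (\<Sum>x\<in>A. (cmod (a x))\<^sup>2)"
    have q: "0 < q"
      unfolding q_def using a(1) A(1) by (auto intro!: sum_pos2)
    have "(l2_norm Y \<xi>)\<^sup>2 = (\<Sum>x\<in>A. (cmod (a x))\<^sup>2 * (l2_norm Y (P {x} (ket (f x))))\<^sup>2)"
      unfolding \<xi>_def using A(1) fA by (intro l2_norm_orthogonal_combination) auto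
    also have "\<dots> \<le> q"
      unfolding q_def
    proof (intro sum_mono mult_left_le)
      fix x assume x: "x \<in> A"
      show "(l2_norm Y (P {x} (ket (f x))))\<^sup>2 \<le> 1"
        using m_le_1[of "{x}" "f x"] x A(2) fA(1)[OF x] by (auto simp: m_def)
    qed simp
    finally have norm_\<xi>: "(l2_norm Y \<xi>)\<^sup>2 \<le> q" .
    define E where "E = f ` A"
    have E: "finite E" "E \<subseteq> Y" using A fA by (auto simp: E_def)
    obtain S where S: "(\<Sum>x\<in>A. \<Sum>z\<in>E. (cmod (a x * P {x} (ket (f x)) z))\<^sup>2) \<le>
        (\<Sum>z\<in>E. (cmod ((\<Sum>x\<in>A \<inter> S. a x * P {x} (ket (f x)) z) - (\<Sum>x\<in>A - S. a x * P {x} (ket (f x)) z)))\<^sup>2)"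
      using exists_signs_ge[OF A(1), where B = E and v = "\<lambda>x z. a x * P {x} (ket (f x)) z"] by blast
    define w where "w = (\<lambda>z. P (A \<inter> S) \<xi> z - P (A - S) \<xi> z)"
    have P\<xi>: "P T \<xi> = (\<lambda>z. \<Sum>x\<in>A \<inter> T. a x * P {x} (ket (f x)) z)" for T
      unfolding \<xi>_def using A(1) fA by (intro P_orthogonal_combination) auto
    have AI: "A \<inter> (A \<inter> S) = A \<inter> S" "A \<inter> (A - S) = A - S" by blast+
    \<comment> \<open>The single coordinate \<open>z = f x\<close> supplies the lower bound: there
      the summand is \<open>a x * m {x} (f x)\<close>.\<close>
    have "c\<^sup>2 * q \<le> (\<Sum>x\<in>A. \<Sum>z\<in>E. (cmod (a x * P {x} (ket (f x)) z))\<^sup>2)"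
      unfolding q_def sum_distrib_left
    proof (rule sum_mono)
      fix x assume x: "x \<in> A"
      have "c\<^sup>2 * (cmod (a x))\<^sup>2 \<le> (m {x} (f x))\<^sup>2 * (cmod (a x))\<^sup>2"
        using c fA(2)[OF x] by (intro mult_right_mono power_mono) auto
      also have "\<dots> = (cmod (a x * P {x} (ket (f x)) (f x)))\<^sup>2"
        using fA(1)[OF x] by (simp add: P_diag norm_mult power_mult_distrib)
      also have "\<dots> \<le> (\<Sum>z\<in>E. (cmod (a x * P {x} (ket (f x)) z))\<^sup>2)"
        using E(1) x by (intro member_le_sum) (auto simp: E_def)
      finally show "c\<^sup>2 * (cmod (a x))\<^sup>2 \<le> (\<Sum>z\<in>E. (cmod (a x * P {x} (ket (f x)) z))\<^sup>2)" .
    qed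
    also have "\<dots> \<le> (\<Sum>z\<in>E. (cmod (w z))\<^sup>2)"
      using S unfolding w_def P\<xi> AI .
    also have "\<dots> = (l2_norm Y (proj E w))\<^sup>2"
      by (simp add: l2_proj_finite[OF E] L2_set_def sum_nonneg)
    also have "\<dots> \<le> (c / 2 * l2_norm Y \<xi>)\<^sup>2"
    proof (rule power_mono)
      have near: "l2_norm Y (proj E (P T \<xi>)) \<le> c / 4 * l2_norm Y \<xi>" if "T \<subseteq> X" for T
      proof -
        have "l2_norm Y (proj E (P T (proj (Y - N) \<xi>))) \<le> c / 4 * l2_norm Y \<xi>"
          using E(2) by (intro ql_boundD[OF r(2)[OF that]] \<xi>) (auto simp: N_def E_def)
        then show ?thesis by (simp add: supp)
      qed
      have "proj E w = (\<lambda>z. proj E (P (A \<inter> S) \<xi>) z - proj E (P (A - S) \<xi>) z)"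
        by (auto simp: proj_def w_def)
      then have "l2_norm Y (proj E w) \<le> l2_norm Y (proj E (P (A \<inter> S) \<xi>)) + l2_norm Y (proj E (P (A - S) \<xi>))"
        using \<xi> by (simp add: l2_norm_triangle_diff l2_proj)
      also have "\<dots> \<le> c / 4 * l2_norm Y \<xi> + c / 4 * l2_norm Y \<xi>"
        using A(2) by (intro add_mono near) auto
      finally show "l2_norm Y (proj E w) \<le> c / 2 * l2_norm Y \<xi>" by (simp add: field_simps)
    qed simp
    also have "\<dots> \<le> c\<^sup>2 / 4 * q"
      using norm_\<xi> by (simp add: power_mult_distrib power_divide mult_left_mono)
    finally have "c\<^sup>2 * q \<le> c\<^sup>2 * q / 4" by simp
    moreover have "0 < c\<^sup>2 * q" using c q by simp
    ultimately show False by linarith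
  qed
  then show ?thesis using r(1) by blast
qed

end

section \<open>Assembly of the bijective coarse equivalence\<close>

context ql_iso
begin

interpretation inv: ql_iso Y dY X dX \<psi>
  by (rule ql_iso_inverse)

lemma bij_coarse_equiv: "bij_coarse_equiv X dX Y dY"
proof -
  interpret MX: Metric_space X dX by (rule mX)
  interpret MY: Metric_space Y dY by (rule mY)
  obtain c1 where c1: "c1 > 0" "\<forall>x\<in>X. \<exists>y\<in>Y. c1 \<le> inv.m {y} x" using inv.exists_large_entry by blast
  obtain c2 where c2: "c2 > 0" "\<forall>y\<in>Y. \<exists>x\<in>X. c2 \<le> m {x} y" using exists_large_entry by blast
  \<comment> \<open>One threshold for both maps: by \<open>m_symmetric\<close>, the pairs
    \<open>(x, f x)\<close> and \<open>(g y, y)\<close> then have large entries for \<phi> as well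
    as for \<psi>.\<close>
  define c where "c = min c1 c2"
  have c: "c > 0" "c \<le> c1" "c \<le> c2" using c1 c2 by (auto simp: c_def)
  have "\<forall>x\<in>X. \<exists>y. y \<in> Y \<and> c \<le> m {x} y"
    using c1(2) c(2) m_symmetric by (metis order_trans)
  then obtain f where f: "\<And>x. x \<in> X \<Longrightarrow> f x \<in> Y" "\<And>x. x \<in> X \<Longrightarrow> c \<le> m {x} (f x)" by metis
  have "\<forall>y\<in>Y. \<exists>x. x \<in> X \<and> c \<le> m {x} y"
    using c2(2) c(3) by (metis order_trans)
  then obtain g where g: "\<And>y. y \<in> Y \<Longrightarrow> g y \<in> X" "\<And>y. y \<in> Y \<Longrightarrow> c \<le> m {g y} y" by metis
  have f': "c \<le> inv.m {f x} x" if "x \<in> X" for x using f that m_symmetric by simp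
  have g': "c \<le> inv.m {y} (g y)" if "y \<in> Y" for y using g that m_symmetric by simp
  have coarse_f: "\<exists>k>0. \<forall>x\<in>X. \<forall>x'\<in>X. dX x x' \<le> s \<longrightarrow> dY (f x) (f x') \<le> k" if "s > 0" for s
    using near_entries[OF c(1) that] f by meson
  have coarse_g: "\<exists>k>0. \<forall>y\<in>Y. \<forall>y'\<in>Y. dY y y' \<le> s \<longrightarrow> dX (g y) (g y') \<le> k" if "s > 0" for s
    using inv.near_entries[OF c(1) that] g(1) g' by meson
  \<comment> \<open>\<open>f (g y)\<close> and \<open>y\<close> both have a large entry with
    \<open>g y\<close>, so \<open>near_entries\<close> applies with two equal points.\<close>
  obtain k1 where k1: "k1 > 0" "\<And>y. y \<in> Y \<Longrightarrow> dY (f (g y)) y \<le> k1"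
  proof -
    obtain k where k: "k > 0" "\<forall>x\<in>X. \<forall>x'\<in>X. \<forall>y\<in>Y. \<forall>y'\<in>Y.
        dX x x' \<le> 1 \<longrightarrow> c \<le> m {x} y \<longrightarrow> c \<le> m {x'} y' \<longrightarrow> dY y y' \<le> k"
      using near_entries[OF c(1) zero_less_one] by blast
    have "dY (f (g y)) y \<le> k" if "y \<in> Y" for y
    proof -
      have "dX (g y) (g y) \<le> 1" using g(1)[OF that] MX.zero[of "g y" "g y"] by simp
      then show ?thesis using k(2) f g that by blast
    qed
    then show ?thesis using that k(1) by blast
  qed
  obtain k2 where k2: "k2 > 0" "\<And>x. x \<in> X \<Longrightarrow> dX (g (f x)) x \<le> k2"
  proof -
    obtain k where k: "k > 0" "\<forall>x\<in>Y. \<forall>x'\<in>Y. \<forall>y\<in>X. \<forall>y'\<in>X.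
        dY x x' \<le> 1 \<longrightarrow> c \<le> inv.m {x} y \<longrightarrow> c \<le> inv.m {x'} y' \<longrightarrow> dX y y' \<le> k"
      using inv.near_entries[OF c(1) zero_less_one] by blast
    have "dX (g (f x)) x \<le> k" if "x \<in> X" for x
    proof -
      have "dY (f x) (f x) \<le> 1" using f(1)[OF that] MY.zero[of "f x" "f x"] by simp
      then show ?thesis using k(2) f(1) g(1) f' g' that by blast
    qed
    then show ?thesis using that k(1) by blast
  qed
  obtain k3 where k3: "k3 > 0" and Hall_f: "\<forall>f. (\<forall>x\<in>X. f x \<in> Y \<and> c \<le> m {x} (f x)) \<longrightarrow>
      (\<forall>A. finite A \<longrightarrow> A \<subseteq> X \<longrightarrow> card A \<le> card (\<Union>x\<in>A. {y \<in> Y. dY (f x) y \<le> k3}))"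
    using Hall_condition[OF c(1)] by (elim exE conjE)
  obtain k4 where k4: "k4 > 0" and Hall_g: "\<forall>g. (\<forall>y\<in>Y. g y \<in> X \<and> c \<le> inv.m {y} (g y)) \<longrightarrow>
      (\<forall>A. finite A \<longrightarrow> A \<subseteq> Y \<longrightarrow> card A \<le> card (\<Union>y\<in>A. {x \<in> X. dX (g y) x \<le> k4}))"
    using inv.Hall_condition[OF c(1)] by (elim exE conjE)
  have "\<exists>F. inj_on F X \<and> (\<forall>x\<in>X. F x \<in> {y \<in> Y. dY (f x) y \<le> k3})"
  proof (rule Hall_injection)
    show "finite {y \<in> Y. dY (f x) y \<le> k3}" if "x \<in> X" for x
      using ulfY[unfolded ulf_def, rule_format, OF k3] f(1)[OF that] by blast
    show "card A \<le> card (\<Union>x\<in>A. {y \<in> Y. dY (f x) y \<le> k3})" if "finite A" "A \<subseteq> X" for A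
      using Hall_f[THEN spec[of _ f]] f that by simp
  qed
  then obtain F where F: "inj_on F X" "\<And>x. x \<in> X \<Longrightarrow> F x \<in> Y \<and> dY (f x) (F x) \<le> k3" by auto
  have "\<exists>G. inj_on G Y \<and> (\<forall>y\<in>Y. G y \<in> {x \<in> X. dX (g y) x \<le> k4})"
  proof (rule Hall_injection)
    show "finite {x \<in> X. dX (g y) x \<le> k4}" if "y \<in> Y" for y
      using ulfX[unfolded ulf_def, rule_format, OF k4] g(1)[OF that] by blast
    show "card A \<le> card (\<Union>y\<in>A. {x \<in> X. dX (g y) x \<le> k4})" if "finite A" "A \<subseteq> Y" for A
      using Hall_g[THEN spec[of _ g]] g(1) g' that by simp
  qed
  then obtain G where G: "inj_on G Y" "\<And>y. y \<in> Y \<Longrightarrow> G y \<in> X \<and> dX (g y) (G y) \<le> k4" by auto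
  have "F ` X \<subseteq> Y" "G ` Y \<subseteq> X" using F(2) G(2) by auto
  then obtain h where h: "bij_betw h X Y" "\<And>x. x \<in> X \<Longrightarrow> h x = F x \<or> G (h x) = x"
    using Cantor_Bernstein_pieces[OF F(1) _ G(1)] by metis
  have hY: "h x \<in> Y" if "x \<in> X" for x using h(1) that by (auto simp: bij_betw_def)
  obtain k5 where k5: "k5 > 0" "\<And>x x'. x \<in> X \<Longrightarrow> x' \<in> X \<Longrightarrow> dX x x' \<le> k4 \<Longrightarrow> dY (f x) (f x') \<le> k5"
    using coarse_f[OF k4] by blast
  \<comment> \<open>Covers both Cantor-Bernstein cases: \<open>k3\<close> when
    \<open>h x = F x\<close>; otherwise \<open>g (h x)\<close> is within \<open>k4\<close> of
    \<open>x\<close>, which costs \<open>k5\<close> after applying \<open>f\<close>, and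
    \<open>k1\<close> more from \<open>f (g (h x))\<close> to \<open>h x\<close>.\<close>
  define C where "C = k3 + k1 + k5"
  have C: "C > 0" using k1 k3 k5 by (simp add: C_def)
  have hf: "dY (h x) (f x) \<le> C" if x: "x \<in> X" for x
    using h(2)[OF x]
  proof
    assume "h x = F x"
    then show ?thesis using F(2)[OF x] k1(1) k5(1) MY.commute[of "F x" "f x"] by (simp add: C_def)
  next
    assume Gx: "G (h x) = x"
    have y: "h x \<in> Y" using x by (rule hY)
    have "dX (g (h x)) x \<le> k4" using G(2)[OF y] Gx by simp
    then have "dY (f (g (h x))) (f x) \<le> k5" using k5(2) g(1) x y by blast
    moreover have "dY (h x) (f (g (h x))) \<le> k1" using k1(2)[OF y] MY.commute by simp
    moreover have "dY (h x) (f x) \<le> dY (h x) (f (g (h x))) + dY (f (g (h x))) (f x)"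
      using x y f g by (intro MY.triangle) auto
    ultimately show ?thesis using k3 by (simp add: C_def)
  qed
  have "coarse_map X dX dY h"
    unfolding coarse_map_def
  proof (intro allI impI)
    fix r :: real assume "r > 0"
    then obtain k where k: "k > 0" "\<And>x x'. x \<in> X \<Longrightarrow> x' \<in> X \<Longrightarrow> dX x x' \<le> r \<Longrightarrow> dY (f x) (f x') \<le> k"
      using coarse_f by blast
    have "dY (h x) (h x') \<le> 2 * C + k" if x: "x \<in> X" "x' \<in> X" and "dX x x' \<le> r" for x x'
    proof -
      have "dY (h x) (h x') \<le> dY (h x) (f x) + dY (f x) (h x')"
        using x f hY by (intro MY.triangle) auto
      moreover have "dY (f x) (h x') \<le> dY (f x) (f x') + dY (f x') (h x')"
        using x f hY by (intro MY.triangle) auto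
      moreover have "dY (f x') (h x') \<le> C" using hf[OF x(2)] MY.commute by simp
      ultimately show ?thesis using hf[OF x(1)] k(2)[OF that] by linarith
    qed
    moreover have "2 * C + k > 0" using C k by simp
    ultimately show "\<exists>s>0. \<forall>x\<in>X. \<forall>x'\<in>X. dX x x' \<le> r \<longrightarrow> dY (h x) (h x') \<le> s" by blast
  qed
  \<comment> \<open>\<open>g\<close> need not be the inverse of \<open>h\<close>; it is a coarse
    inverse because \<open>h\<close> stays within \<open>C\<close> of \<open>f\<close>.\<close>
  moreover have "coarse_map Y dY dX g" unfolding coarse_map_def using coarse_g by blast
  moreover have "close_maps Y dY (h \<circ> g) id"
    unfolding close_maps_def
  proof (intro exI ballI)
    fix y assume y: "y \<in> Y"
    have "dY (h (g y)) y \<le> dY (h (g y)) (f (g y)) + dY (f (g y)) y"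
      using y f g hY by (intro MY.triangle) auto
    then show "dY ((h \<circ> g) y) (id y) \<le> C + k1" using hf[OF g(1)[OF y]] k1(2)[OF y] by simp
  qed
  moreover obtain k6 where k6: "\<And>y y'. y \<in> Y \<Longrightarrow> y' \<in> Y \<Longrightarrow> dY y y' \<le> C \<Longrightarrow> dX (g y) (g y') \<le> k6"
    using coarse_g[OF C] by blast
  have "close_maps X dX (g \<circ> h) id"
    unfolding close_maps_def
  proof (intro exI ballI)
    fix x assume x: "x \<in> X"
    have "dX (g (h x)) x \<le> dX (g (h x)) (g (f x)) + dX (g (f x)) x"
      using x f g hY by (intro MX.triangle) auto
    moreover have "dX (g (h x)) (g (f x)) \<le> k6" using k6 hf x f hY by blast
    ultimately show "dX ((g \<circ> h) x) (id x) \<le> k6 + k2" using k2(2)[OF x] by simp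
  qed
  ultimately have "coarse_equivalence X dX Y dY h"
    unfolding coarse_equivalence_def using hY g(1) by blast
  then show ?thesis unfolding bij_coarse_equiv_def using h(1) by blast
qed

end

theorem theorem3p2:
  fixes X :: "'a set" and dX :: "'a \<Rightarrow> 'a \<Rightarrow> real"
    and Y :: "'b set" and dY :: "'b \<Rightarrow> 'b \<Rightarrow> real"
  assumes "Metric_space X dX" and "Metric_space Y dY"
    and "ulf X dX" and "ulf Y dY"
    and "\<exists>\<phi>. star_isomorphism X dX Y dY \<phi>"
  shows "bij_coarse_equiv X dX Y dY"
proof -
  obtain \<phi> where "star_isomorphism X dX Y dY \<phi>" using assms(5) by blast
  then have "ql_iso X dX Y dY \<phi>" using assms(1-4) by (intro ql_iso.intro)
  then show ?thesis by (rule ql_iso.bij_coarse_equiv)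
qed

end
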